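(* Let $0<\beta<1$ and let $\rho$ be a probability measure on $\mathbb R$ satisfying $$\int_{-\infty}^\infty x\,d\rho(x)=0,\qquad \int_{-\infty}^\infty x^2\,d\rho(x)=1,\qquad \int_{-\infty}^\infty e^{tx}\,d\rho(x)\le e^{t^2/2}\ \text{ for all } t\in\mathbb R.$$ For $n\ge1$ let $(X_1,\dots,X_n)$ have joint distribution $$dP_{n,\beta}(x)=Z_n^{-1}\exp\Bigl(\frac{\beta}{2n}(x_1+\dots+x_n)^2\Bigr)\prod_{i=1}^n d\rho(x_i),\qquad x=(x_1,\dots,x_n)\in\mathbb R^n,$$ where $Z_n=\int\exp\bigl(\frac{\beta}{2n}(x_1+\dots+x_n)^2\bigr)\prod_{i=1}^n d\rho(x_i)$, and let $$W=n^{-1/2}(1-\beta)^{1/2}\sum_{i=1}^nX_i.$$ Then there is a constant $C$ depending only on $\beta$ such that $$\left|\frac{\mathbb P(W>z)}{1-\Phi(z)}-1\right|\le C\,n^{-1/2}(1+z^3)\qquad\text{for } 0\le z\le\sqrt n.$$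
   Context: $\Phi$ is the standard normal distribution function. *)

theory Defs
  imports "HOL-Probability.Probability"
begin

(* Points of R^n are the elements of the space of the product measure
   PiM {1..n}, i.e. functions on {1..n}. *)

definition partition_function :: "real \<Rightarrow> real measure \<Rightarrow> nat \<Rightarrow> real" where
  "partition_function \<beta> \<rho> n =
     (LINT x|PiM {1..n} (\<lambda>_. \<rho>). exp (\<beta> / (2 * real n) * (\<Sum>i=1..n. x i)\<^sup>2))"

(* The integrand of the partition function is integrable when 0 < \<beta> < 1 and the moment
   generating function of \<rho> is at most exp (t^2 / 2) for all t (the integral is then at most
   (1 - \<beta>) powr (-1/2)), so the Bochner integral is the true value. *)
definition curie_weiss :: "real \<Rightarrow> real measure \<Rightarrow> nat \<Rightarrow> (nat \<Rightarrow> real) measure" where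
  "curie_weiss \<beta> \<rho> n =
     density (PiM {1..n} (\<lambda>_. \<rho>))
       (\<lambda>x. ennreal (exp (\<beta> / (2 * real n) * (\<Sum>i=1..n. x i)\<^sup>2) / partition_function \<beta> \<rho> n))"

definition normalized_sum :: "real \<Rightarrow> nat \<Rightarrow> (nat \<Rightarrow> real) \<Rightarrow> real" where
  "normalized_sum \<beta> n x = real n powr (- 1 / 2) * (1 - \<beta>) powr (1 / 2) * (\<Sum>i=1..n. x i)"

definition std_normal_cdf :: "real \<Rightarrow> real" where
  "std_normal_cdf = cdf std_normal_distribution"

end

theory Submission
  imports Defs "HOL-Real_Asymp.Real_Asymp"
begin

text \<open>
  Let $T = n^{-1/2} \sum_i X_i$ for independent $X_i$ with law $\rho$. Under the Curie-Weiss measure, $T$ has the law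
  of the independent case reweighted by $e^{\beta T^2/2}/Z_n$, and $W = \sqrt{1-\beta}\, T$. A standard normal
  variable reweighted by $e^{\beta x^2/2}$ is normal with variance $1/(1-\beta)$, so everything follows from a
  sufficiently sharp comparison of $T$ with a standard normal variable $N$. That comparison is
  \<open>normal_approximation\<close>: with an absolute constant $K$ and for all $u \ge 0$,
  \[ |P(T > u) - P(N > u)| \le K n^{-1/2} (1 + u^2) e^{-u^2/2} . \]
  Writing $E[e^{\beta T^2/2}; T > t]$ as an integral of the tails $P(T > u)$, $u \ge t$ (\<open>tail_comparison\<close>), turns
  this bound into the error $O(n^{-1/2} (1 + t^2) e^{-(1-\beta) t^2/2})$, and at $t = z / \sqrt{1-\beta}$ the
  factor $e^{-z^2/2}$ is at most a multiple of $(1 + z)(1 - \Phi(z))$. The normalisation $Z_n$ is compared with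
  $(1-\beta)^{-1/2}$ by the Hubbard-Stratonovich transform (\<open>exp_square_moment\<close>).
\<close>

text \<open>
  The comparison of $T$ with $N$ is Cramer's method. Let $M(\theta)$ be the moment generating function of $\rho$ and
  $\theta = u / \sqrt n$. Tilting by $e^{uT}/M(\theta)^n$ moves the point $u$ to the centre of the law of $T$, and
  \[ P(T > u) = M(\theta)^n e^{-u^2}\, E^{tilt}[e^{-u (T - u)}; T > u] . \]
  The same identity for $N$ has $e^{u^2/2}$ in place of $M(\theta)^n$. The ratio
  $r = M(\theta)^n e^{-u^2/2}$ satisfies $1 - 46 u^3/\sqrt n \le r \le 1$: the upper bound is the hypothesis on $\rho$,
  the lower bound is a Taylor expansion to third order. The tilted expectation is compared with the normal one through a
  bound on the distance of the tail functions, that is, through a Berry-Esseen estimate for the tilted law with the error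
  $O((1+u^2)/\sqrt n)$ (\<open>tilted_law_close_to_normal\<close>). When $(1+u^2)/\sqrt n$ is not small the claim is weaker than
  the Chernoff bound $e^{-u^2/2}$, which both tails obey.

  The Berry-Esseen estimate is Fourier-analytic. Its first part is a smoothing inequality (\<open>smoothing_inequality\<close>):
  the tails of two laws are close if their characteristic functions are close on a long interval. Its second part
  (\<open>tilted_char_power\<close>) bounds the distance of the characteristic functions by Taylor expansion.
\<close>

section \<open>A smoothing inequality for tail functions\<close>

text \<open>
  A variant of the bound for integrals in which only the dominating function has to be integrable.
\<close>

lemma norm_integral_le:
  fixes f :: "'a \<Rightarrow> 'b::{banach, second_countable_topology}"
  assumes "integrable M g" and bound: "\<And>x. x \<in> space M \<Longrightarrow> norm (f x) \<le> g x"
  shows "norm (\<integral>x. f x \<partial>M) \<le> (\<integral>x. g x \<partial>M)"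
proof -
  have "norm (\<integral>x. f x \<partial>M) \<le> (\<integral>x. norm (f x) \<partial>M)"
    by (rule integral_norm_bound)
  also have "\<dots> \<le> (\<integral>x. g x \<partial>M)"
    using assms(1) by (rule integral_mono') (use bound order_trans[OF norm_ge_zero bound] in auto)
  finally show ?thesis .
qed

text \<open>
  A band-limited approximation of the sign function. The Dirichlet integral of $\sin(tx)/t$ over $t > 0$ is
  $\frac\pi2 \mathrm{sgn}\, x$; cutting it off at $t = 1$ with a factor that is smooth at $0$ keeps the error as small as
  $O(x^{-2})$, whereas a cut-off with a corner at $0$ would only give $O(|x|^{-1})$.
\<close>

definition smooth_sgn :: "real \<Rightarrow> real" where
  "smooth_sgn x = 2 / pi * (LBINT t:{0..1}. (1 - t\<^sup>2) * sin (t * x) / t)"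

text \<open>
  The Fejer kernel $2 (1 - \cos x)/x^2$, written as a Fourier integral so that its expectation can be read off from the
  characteristic function.
\<close>

definition fejer_kernel :: "real \<Rightarrow> real" where
  "fejer_kernel x = (LBINT t:{0..1}. 2 * (1 - t) * cos (t * x))"

lemma abs_sin_div_le: "\<bar>(1 - t\<^sup>2) * sin (t * x) / t\<bar> \<le> \<bar>x\<bar>" if "t \<in> {0..1}" for t x :: real
proof (cases "t = 0")
  case False
  with that have t: "0 < t" "t \<le> 1" by auto
  have "\<bar>sin (t * x)\<bar> \<le> \<bar>t * x\<bar>"
    by (rule abs_sin_x_le_abs_x)
  moreover have "\<bar>1 - t\<^sup>2\<bar> \<le> 1"
    using t by (auto simp: abs_le_iff power_le_one)
  ultimately have "\<bar>1 - t\<^sup>2\<bar> * \<bar>sin (t * x)\<bar> \<le> 1 * \<bar>t * x\<bar>"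
    by (intro mult_mono) auto
  then show ?thesis
    using t by (simp add: abs_mult abs_divide divide_le_eq mult_ac)
qed simp

lemma smooth_sgn_minus: "smooth_sgn (- x) = - smooth_sgn x"
  by (simp add: smooth_sgn_def set_lebesgue_integral_def)

lemma smooth_sgn_eq_Si:
  assumes "0 < x"
  shows "pi / 2 * smooth_sgn x = Si x + cos x / x - sin x / x\<^sup>2"
proof -
  have bnd: "\<bar>sin (t * x) / t\<bar> \<le> \<bar>x\<bar>" for t
    using abs_sin_x_le_abs_x[of "t * x"]
    by (cases "t = 0") (auto simp: abs_mult abs_divide divide_le_eq mult.commute)
  have 1: "(LBINT t:{0..1}. sin (t * x) / t) = Si x"
    using LBINT_I0c_sin_scale_divide[of 1 x] interval_integral_Icc[of 0 1 "\<lambda>t. sin (t * x) / t"] assms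
    by (simp add: zero_ereal_def)
  have 2: "set_integrable lborel {0..1} (\<lambda>t. sin (t * x) / t)"
    unfolding set_integrable_def
  proof (rule Bochner_Integration.integrable_bound)
    show "integrable lborel (\<lambda>t. indicat_real {0..1::real} t * \<bar>x\<bar>)"
      by (intro integrable_mult_left integrable_real_indicator) auto
    have "norm (indicat_real {0..1::real} t *\<^sub>R (sin (t * x) / t)) \<le> norm (indicat_real {0..1::real} t * \<bar>x\<bar>)" for t
      using bnd[of t] by (auto simp: indicator_def simp del: abs_divide)
    then show "AE t in lborel. norm (indicat_real {0..1::real} t *\<^sub>R (sin (t * x) / t)) \<le> norm (indicat_real {0..1::real} t * \<bar>x\<bar>)"
      by simp
  qed simp
  have "has_bochner_integral lborel (\<lambda>t. (t * sin (t * x)) * indicator {0..1} t)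
     ((- 1 * cos (1 * x) / x + sin (1 * x) / x\<^sup>2) - (- 0 * cos (0 * x) / x + sin (0 * x) / x\<^sup>2))"
  proof (rule has_bochner_integral_FTC_Icc_real[where F = "\<lambda>t. - t * cos (t * x) / x + sin (t * x) / x\<^sup>2"])
    fix t :: real
    show "((\<lambda>t. - t * cos (t * x) / x + sin (t * x) / x\<^sup>2) has_real_derivative t * sin (t * x)) (at t)"
      using assms by (auto intro!: derivative_eq_intros simp: power2_eq_square field_simps)
  qed (use assms in \<open>auto intro!: continuous_intros\<close>)
  then have 3: "set_integrable lborel {0..1} (\<lambda>t. t * sin (t * x))"
    "(LBINT t:{0..1}. t * sin (t * x)) = - cos x / x + sin x / x\<^sup>2"
    by (auto simp: has_bochner_integral_iff set_integrable_def set_lebesgue_integral_def mult.commute)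
  have "(LBINT t:{0..1}. (1 - t\<^sup>2) * sin (t * x) / t)
      = (LBINT t:{0..1}. sin (t * x) / t - t * sin (t * x))"
  proof (intro set_lebesgue_integral_cong allI impI)
    fix t :: real
    show "(1 - t\<^sup>2) * sin (t * x) / t = sin (t * x) / t - t * sin (t * x)"
      by (cases "t = 0") (auto simp: field_simps power2_eq_square)
  qed simp
  also have "\<dots> = Si x + cos x / x - sin x / x\<^sup>2"
    using 1 2 3 by (simp add: set_integral_diff)
  finally show ?thesis
    unfolding smooth_sgn_def by (simp, simp add: mult.commute)
qed

text \<open>
  The decay is proved by monotonicity: \<open>G\<close> is $\frac\pi2$ times the sign approximation with the oscillating term of order $x^{-2}$ flipped, chosen so that its
  derivative is only of order $x^{-3}$. Hence $G(x) \pm x^{-2}$ are monotone, and both tend to $\pi/2$.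
\<close>

lemma smooth_sgn_tail:
  assumes "0 < x"
  shows "\<bar>1 - smooth_sgn x\<bar> \<le> 2 / x\<^sup>2"
proof -
  define G where "G y = Si y + cos y / y + sin y / y\<^sup>2" for y :: real
  have G': "(G has_real_derivative - (2 * sin y / y ^ 3)) (at y)" if "0 < y" for y
    unfolding G_def using that
    by (auto intro!: derivative_eq_intros DERIV_Si simp: field_simps power2_eq_square power3_eq_cube)
  have lim0: "((\<lambda>y. cos y / y + sin y / y\<^sup>2 + c / y\<^sup>2) \<longlongrightarrow> 0) at_top" for c :: real
    by real_asymp
  have lim: "((\<lambda>y. G y + c / y\<^sup>2) \<longlongrightarrow> pi / 2) at_top" for c
    using tendsto_add[OF Si_at_top lim0[of c]] by (simp add: G_def add_ac)
  have D: "((\<lambda>y. G y + c / y\<^sup>2) has_real_derivative - (2 * sin y / y ^ 3) - 2 * c / y ^ 3) (at y)"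
    if "0 < y" for c y
    using that by (auto intro!: derivative_eq_intros G' simp: field_simps power2_eq_square power3_eq_cube)
  have up: "G x - 1 / x\<^sup>2 \<le> pi / 2"
  proof (rule tendsto_lowerbound[OF lim[of "-1"]])
    show "\<forall>\<^sub>F y in at_top. G x - 1 / x\<^sup>2 \<le> G y + - 1 / y\<^sup>2"
      using eventually_ge_at_top[of x]
    proof eventually_elim
      case (elim y)
      have "G x + - 1 / x\<^sup>2 \<le> G y + - 1 / y\<^sup>2"
      proof (rule DERIV_nonneg_imp_nondecreasing[OF elim])
        fix u assume u: "x \<le> u" "u \<le> y"
        then show "\<exists>d. ((\<lambda>y. G y + - 1 / y\<^sup>2) has_real_derivative d) (at u) \<and> 0 \<le> d"
          using assms sin_le_one[of u] D[of u "-1"]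
          by (intro exI[of _ "- (2 * sin u / u ^ 3) - 2 * (-1) / u ^ 3"])
             (auto simp: divide_right_mono)
      qed
      then show ?case by simp
    qed
  qed simp
  have lo: "pi / 2 \<le> G x + 1 / x\<^sup>2"
  proof (rule tendsto_upperbound[OF lim[of 1]])
    show "\<forall>\<^sub>F y in at_top. G y + 1 / y\<^sup>2 \<le> G x + 1 / x\<^sup>2"
      using eventually_ge_at_top[of x]
    proof eventually_elim
      case (elim y)
      show "G y + 1 / y\<^sup>2 \<le> G x + 1 / x\<^sup>2"
      proof (rule DERIV_nonpos_imp_nonincreasing[OF elim])
        fix u assume u: "x \<le> u" "u \<le> y"
        have "- (2 * sin u) - 2 \<le> 0" using sin_ge_minus_one[of u] by linarith
        then have "(- (2 * sin u) - 2) / u ^ 3 \<le> 0"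
          using u assms by (intro divide_nonpos_pos) auto
        then show "\<exists>d. ((\<lambda>y. G y + 1 / y\<^sup>2) has_real_derivative d) (at u) \<and> d \<le> 0"
          using u assms D[of u 1]
          by (intro exI[of _ "- (2 * sin u / u ^ 3) - 2 * 1 / u ^ 3"])
             (auto simp: diff_divide_distrib)
      qed
    qed
  qed simp
  have s: "\<bar>sin x / x\<^sup>2\<bar> \<le> 1 / x\<^sup>2"
    by (simp add: abs_divide divide_right_mono)
  have "pi / 2 * (1 - smooth_sgn x) = pi / 2 - G x + 2 * (sin x / x\<^sup>2)"
    unfolding right_diff_distrib smooth_sgn_eq_Si[OF assms] G_def by simp
  then have "\<bar>pi / 2 * (1 - smooth_sgn x)\<bar> \<le> 3 * (1 / x\<^sup>2)"
    using up lo s unfolding abs_le_iff by linarith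
  also have "\<dots> \<le> pi / 2 * (2 / x\<^sup>2)"
    using pi_gt3 assms by (simp add: field_simps)
  finally have "pi / 2 * \<bar>1 - smooth_sgn x\<bar> \<le> pi / 2 * (2 / x\<^sup>2)"
    by (simp only: abs_mult) simp
  then show ?thesis
    by (rule mult_left_le_imp_le) simp
qed

lemma abs_smooth_sgn_le: "\<bar>smooth_sgn x\<bar> \<le> \<bar>x\<bar>"
proof -
  have "\<bar>LBINT t:{0..1}. (1 - t\<^sup>2) * sin (t * x) / t\<bar> \<le> (LBINT t:{0..1::real}. \<bar>x\<bar>)"
    unfolding set_lebesgue_integral_def real_norm_def[symmetric]
  proof (rule norm_integral_le)
    show "integrable lborel (\<lambda>t. indicat_real {0..1::real} t *\<^sub>R norm x)"
      by (intro integrable_scaleR_left integrable_real_indicator) auto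
    show "norm (indicat_real {0..1::real} t *\<^sub>R ((1 - t\<^sup>2) * sin (t * x) / t)) \<le> indicat_real {0..1::real} t *\<^sub>R norm x" for t
      using abs_sin_div_le[of _ x] by (auto simp: indicator_def)
  qed
  also have "\<dots> = \<bar>x\<bar>"
    by (simp add: set_lebesgue_integral_def)
  finally show ?thesis
    using pi_gt3 mult_mono[of "2/pi" 1 "\<bar>LBINT t:{0..1}. (1 - t\<^sup>2) * sin (t * x) / t\<bar>" "\<bar>x\<bar>"]
    by (simp add: smooth_sgn_def abs_mult)
qed

lemma fejer_kernel_eq:
  assumes "x \<noteq> 0"
  shows "fejer_kernel x = 2 * (1 - cos x) / x\<^sup>2"
proof -
  have "has_bochner_integral lborel (\<lambda>t. (2 * (1 - t) * cos (t * x)) * indicator {0..1} t)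
     ((2 * (1 - 1) * sin (1 * x) / x - 2 * cos (1 * x) / x\<^sup>2) - (2 * (1 - 0) * sin (0 * x) / x - 2 * cos (0 * x) / x\<^sup>2))"
  proof (rule has_bochner_integral_FTC_Icc_real[where F = "\<lambda>t. 2 * (1 - t) * sin (t * x) / x - 2 * cos (t * x) / x\<^sup>2"])
    fix t :: real
    show "((\<lambda>t. 2 * (1 - t) * sin (t * x) / x - 2 * cos (t * x) / x\<^sup>2) has_real_derivative 2 * (1 - t) * cos (t * x)) (at t)"
      using assms by (auto intro!: derivative_eq_intros simp: power2_eq_square divide_simps algebra_simps)
  qed (use assms in \<open>auto intro!: continuous_intros\<close>)
  then show ?thesis
    by (simp add: fejer_kernel_def has_bochner_integral_iff set_lebesgue_integral_def mult.commute
        diff_divide_distrib algebra_simps)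
qed

lemma fejer_kernel_0: "fejer_kernel 0 = 1"
proof -
  have "has_bochner_integral lborel (\<lambda>t. (2 * (1 - t)) * indicator {0..1} t)
     ((2 * 1 - 1\<^sup>2) - (2 * 0 - 0\<^sup>2::real))"
    by (rule has_bochner_integral_FTC_Icc_real[where F = "\<lambda>t. 2 * t - t\<^sup>2"])
       (auto intro!: derivative_eq_intros continuous_intros)
  then show ?thesis
    by (simp add: fejer_kernel_def has_bochner_integral_iff set_lebesgue_integral_def mult.commute)
qed

lemma fejer_kernel_ge: "2 * (1 - cos x) / c\<^sup>2 \<le> fejer_kernel x" if "\<bar>x\<bar> \<le> c" for x c
proof (cases "x = 0")
  case False
  then have "x\<^sup>2 \<le> c\<^sup>2"
    using that by (metis abs_ge_zero power2_abs power_mono)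
  then show ?thesis
    unfolding fejer_kernel_eq[OF False] using False that
    by (intro divide_left_mono) (auto simp: zero_less_mult_iff)
qed (simp add: fejer_kernel_0)

text \<open>
  The kernel has zeros at the nonzero multiples of $2\pi$; shifting it by $\pi$ exchanges $1 - \cos$ and $1 + \cos$, so
  that the sum of the two is bounded below by a function without zeros.
\<close>

lemma fejer_kernel_cover: "4 / (\<bar>x\<bar> + pi)\<^sup>2 \<le> fejer_kernel x + fejer_kernel (x + pi)"
proof -
  have "2 * (1 - cos x) / (\<bar>x\<bar> + pi)\<^sup>2 \<le> fejer_kernel x"
    by (rule fejer_kernel_ge) simp
  moreover have "2 * (1 - cos (x + pi)) / (\<bar>x\<bar> + pi)\<^sup>2 \<le> fejer_kernel (x + pi)"
    by (rule fejer_kernel_ge) (use abs_triangle_ineq[of x pi] in simp)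
  moreover have "4 / (\<bar>x\<bar> + pi)\<^sup>2 = 2 * (1 - cos x) / (\<bar>x\<bar> + pi)\<^sup>2 + 2 * (1 - cos (x + pi)) / (\<bar>x\<bar> + pi)\<^sup>2"
    by (simp add: field_simps add_divide_distrib[symmetric])
  ultimately show ?thesis by linarith
qed

text \<open>
  The error of the sign approximation is $O((1 + |x|)^{-2})$, which two Fejer kernels dominate. These are band-limited
  as well, so that their expectations involve the characteristic function on a bounded interval only.
\<close>

lemma indicator_approx_smooth_sgn:
  "\<bar>2 * indicator {0<..} x - 1 - smooth_sgn x\<bar> \<le> 9 * (fejer_kernel x + fejer_kernel (x + pi))"
proof -
  have pos: "\<bar>1 - smooth_sgn x\<bar> \<le> 36 / (x + pi)\<^sup>2" if x: "0 \<le> x" for x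
  proof (cases "x \<le> 1")
    case True
    have "(x + pi)\<^sup>2 \<le> (1 + 3.2)\<^sup>2"
      using True x pi_less_4 pi_approx by (intro power_mono) auto
    moreover have "0 < (x + pi)\<^sup>2"
      using x pi_gt_zero by (intro zero_less_power) linarith
    ultimately have "2 \<le> 36 / (x + pi)\<^sup>2"
      by (subst le_divide_eq) (auto simp: power2_eq_square)
    moreover have "\<bar>1 - smooth_sgn x\<bar> \<le> 2"
      using abs_smooth_sgn_le[of x] True x by linarith
    ultimately show ?thesis by linarith
  next
    case False
    have "pi \<le> 3.2 * x"
      using False pi_approx by auto
    then have "(x + pi)\<^sup>2 \<le> (4.2 * x)\<^sup>2"
      using False pi_approx by (intro power_mono) auto
    then have "2 / x\<^sup>2 \<le> 36 / (x + pi)\<^sup>2"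
      using x False pi_gt_zero by (simp add: divide_simps power_mult_distrib power2_eq_square) (use pi_gt_zero in linarith)
    then show ?thesis
      using smooth_sgn_tail[of x] False by linarith
  qed
  have "\<bar>2 * indicator {0<..} x - 1 - smooth_sgn x\<bar> \<le> 36 / (\<bar>x\<bar> + pi)\<^sup>2"
    using pos[of x] pos[of "-x"] by (cases "x > 0") (auto simp: smooth_sgn_minus)
  also have "\<dots> = 9 * (4 / (\<bar>x\<bar> + pi)\<^sup>2)" by simp
  also have "\<dots> \<le> 9 * (fejer_kernel x + fejer_kernel (x + pi))"
    by (intro mult_left_mono fejer_kernel_cover) auto
  finally show ?thesis .
qed

lemma (in real_distribution) integral_swap_unit_interval:
  fixes k :: "real \<Rightarrow> real \<Rightarrow> real"
  assumes meas: "(\<lambda>(t, x). k t x) \<in> borel_measurable (borel \<Otimes>\<^sub>M borel)"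
    and bound: "\<And>t x. t \<in> {0..1} \<Longrightarrow> \<bar>k t x\<bar> \<le> h x"
    and h: "integrable M h"
  shows "integrable M (\<lambda>x. LBINT t:{0..1}. k t x)"
    and "(\<integral>x. (LBINT t:{0..1}. k t x) \<partial>M) = (LBINT t:{0..1}. (\<integral>x. k t x \<partial>M))"
    and "set_integrable lborel {0..1} (\<lambda>t. \<integral>x. k t x \<partial>M)"
proof -
  interpret P: pair_sigma_finite M lborel ..
  note meas[measurable]
  define f where "f x t = indicator {0..1} t *\<^sub>R k t x" for x t
  have [measurable]: "(\<lambda>(x, t). f x t) \<in> borel_measurable (M \<Otimes>\<^sub>M lborel)"
    unfolding f_def by measurable
  have f: "norm (f x t) \<le> indicator {0..1} t * h x" for x t
    using bound[of t x] by (auto simp: f_def indicator_def)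
  have int1: "integrable lborel (f x)" for x
  proof (rule Bochner_Integration.integrable_bound)
    show "integrable lborel (\<lambda>t. indicat_real {0..1::real} t * h x)"
      by (intro integrable_mult_left integrable_real_indicator) auto
    have "norm (f x t) \<le> norm (indicat_real {0..1::real} t * h x)" for t
      using f[of x t] by simp
    then show "AE t in lborel. norm (f x t) \<le> norm (indicat_real {0..1::real} t * h x)" by simp
  qed simp
  have int: "integrable (M \<Otimes>\<^sub>M lborel) (\<lambda>(x, t). f x t)"
  proof (rule P.Fubini_integrable)
    have "integrable M (\<lambda>x. \<integral>t. norm (f x t) \<partial>lborel)"
    proof (rule Bochner_Integration.integrable_bound[OF h])
      have "norm (\<integral>t. norm (f x t) \<partial>lborel) \<le> norm (h x)" for x
      proof -
        have "(\<integral>t. norm (f x t) \<partial>lborel) \<le> (\<integral>t. indicat_real {0..1::real} t * h x \<partial>lborel)"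
          by (intro integral_mono integrable_norm int1 f) auto
        then show ?thesis by simp
      qed
      then show "AE x in M. norm (\<integral>t. norm (f x t) \<partial>lborel) \<le> norm (h x)" by simp
    qed measurable
    then show "integrable M (\<lambda>x. \<integral>t. norm (case (x, t) of (x, t) \<Rightarrow> f x t) \<partial>lborel)" by simp
  qed (auto simp: int1)
  show "integrable M (\<lambda>x. LBINT t:{0..1}. k t x)"
    using P.integrable_fst[OF int] by (simp add: f_def set_lebesgue_integral_def)
  have *: "(\<integral>x. f x t \<partial>M) = indicator {0..1} t *\<^sub>R (\<integral>x. k t x \<partial>M)" for t
    by (simp add: f_def)
  show "(\<integral>x. (LBINT t:{0..1}. k t x) \<partial>M) = (LBINT t:{0..1}. (\<integral>x. k t x \<partial>M))"
    using P.Fubini_integral[OF int] by (simp add: * set_lebesgue_integral_def f_def del: scaleR_conv_of_real)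
  show "set_integrable lborel {0..1} (\<lambda>t. \<integral>x. k t x \<partial>M)"
    using P.integrable_snd[OF int] by (simp add: * set_integrable_def)
qed

lemma integral_inverse_square:
  fixes T :: real
  assumes "0 \<le> T"
  shows "has_bochner_integral lborel (\<lambda>t. (1 / (1 + t * T)\<^sup>2) * indicator {0..1} t) (1 / (1 + T))"
proof -
  have "has_bochner_integral lborel (\<lambda>t. (1 / (1 + t * T)\<^sup>2) * indicator {0..1} t)
    (1 / (1 + T))"
  proof (rule has_bochner_integral_FTC_Icc_real[where F = "\<lambda>t::real. t / (1 + t * T)" and a = 0 and b = 1, simplified])
    fix t :: real assume "0 \<le> t" "t \<le> 1"
    then have "1 + t * T > 0" using assms by (intro add_pos_nonneg) auto
    then show "((\<lambda>t. t / (1 + t * T)) has_real_derivative 1 / (1 + t * T)\<^sup>2) (at t)"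
      by (auto intro!: derivative_eq_intros simp: power2_eq_square field_simps)
    then show "isCont (\<lambda>t. 1 / (1 + t * T)\<^sup>2) t"
      using \<open>1 + t * T > 0\<close> by (auto intro!: continuous_intros)
  qed
  then show ?thesis .
qed

lemma set_integral_inverse_square:
  fixes T c :: real
  assumes "0 \<le> T"
  shows "set_integrable lborel {0..1} (\<lambda>t. c * (1 / (1 + t * T)\<^sup>2))"
    and "(LBINT t:{0..1}. c * (1 / (1 + t * T)\<^sup>2)) = c * (1 / (1 + T))"
proof -
  have 1: "set_integrable lborel {0..1} (\<lambda>t. 1 / (1 + t * T)\<^sup>2)"
    "(LBINT t:{0..1}. 1 / (1 + t * T)\<^sup>2) = 1 / (1 + T)"
    using integral_inverse_square[OF assms]
    by (auto simp: has_bochner_integral_iff set_integrable_def set_lebesgue_integral_def mult.commute)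
  show "set_integrable lborel {0..1} (\<lambda>t. c * (1 / (1 + t * T)\<^sup>2))"
    using 1(1) by (intro set_integrable_mult_right)
  show "(LBINT t:{0..1}. c * (1 / (1 + t * T)\<^sup>2)) = c * (1 / (1 + T))"
    using 1(2) by (subst set_integral_mult_right) simp
qed

lemma (in real_distribution) integral_cos_sin_char:
  shows "(\<integral>x. cos (t * (T * x - b)) \<partial>M) = Re (iexp (- (t * b)) * char M (t * T))"
    and "(\<integral>x. sin (t * (T * x - b)) \<partial>M) = Im (iexp (- (t * b)) * char M (t * T))"
proof -
  have *: "iexp (t * (T * x - b)) = iexp (- (t * b)) * iexp (t * T * x)" for x
    by (simp add: exp_add[symmetric] algebra_simps)
  have int: "integrable M (\<lambda>x. iexp (t * (T * x - b)))"
    by (rule integrable_iexp) auto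
  have eq: "iexp (- (t * b)) * char M (t * T) = (CLINT x|M. iexp (t * (T * x - b)))"
    unfolding char_def * by simp
  show "(\<integral>x. cos (t * (T * x - b)) \<partial>M) = Re (iexp (- (t * b)) * char M (t * T))"
    unfolding eq integral_Re[OF int, symmetric] by (simp add: Re_exp)
  show "(\<integral>x. sin (t * (T * x - b)) \<partial>M) = Im (iexp (- (t * b)) * char M (t * T))"
    unfolding eq integral_Im[OF int, symmetric] by (simp add: Im_exp)
qed

lemma (in real_distribution) expectation_fejer_kernel:
  assumes "0 < T" and A: "\<And>t. \<bar>t\<bar> \<le> T \<Longrightarrow> cmod (char M t) \<le> A / (1 + \<bar>t\<bar>)\<^sup>2"
  shows "integrable M (\<lambda>x. fejer_kernel (T * x - b))"
    and "expectation (\<lambda>x. fejer_kernel (T * x - b)) \<le> 2 * A / T"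
proof -
  let ?k = "\<lambda>t x. 2 * (1 - t) * cos (t * (T * x - b))"
  have k: "(\<lambda>(t, x). ?k t x) \<in> borel_measurable (borel \<Otimes>\<^sub>M borel)"
    by measurable
  have kb: "\<bar>?k t x\<bar> \<le> 2" if "t \<in> {0..1}" for t x
    using that mult_mono[of "\<bar>2 * (1 - t)\<bar>" 2 "\<bar>cos (t * (T * x - b))\<bar>" 1] by (auto simp: abs_mult)
  note sw = integral_swap_unit_interval[of ?k "\<lambda>_. 2", OF k kb]
  have A0: "0 \<le> A"
    using order_trans[OF norm_ge_zero A[of 0]] assms(1) by simp
  show "integrable M (\<lambda>x. fejer_kernel (T * x - b))"
    unfolding fejer_kernel_def by (rule sw(1)) auto
  have "expectation (\<lambda>x. fejer_kernel (T * x - b)) = (LBINT t:{0..1}. (\<integral>x. ?k t x \<partial>M))"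
    unfolding fejer_kernel_def by (rule sw(2)) auto
  also have "\<dots> \<le> (LBINT t:{0..1}. 2 * A * (1 / (1 + t * T)\<^sup>2))"
  proof (rule set_integral_mono)
    show "set_integrable lborel {0..1} (\<lambda>t. 2 * A * (1 / (1 + t * T)\<^sup>2))"
      using assms(1) by (intro set_integral_inverse_square) simp
    fix t :: real assume t: "t \<in> {0..1}"
    have "(\<integral>x. ?k t x \<partial>M) = 2 * (1 - t) * Re (iexp (- (t * b)) * char M (t * T))"
      by (simp add: integral_cos_sin_char)
    also have "\<dots> \<le> 2 * (1 - t) * (A / (1 + t * T)\<^sup>2)"
    proof (rule mult_left_mono)
      have "Re (iexp (- (t * b)) * char M (t * T)) \<le> cmod (iexp (- (t * b)) * char M (t * T))"
        by (rule complex_Re_le_cmod)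
      also have "\<dots> = cmod (char M (t * T))"
        by (simp add: norm_mult)
      also have "\<dots> \<le> A / (1 + \<bar>t * T\<bar>)\<^sup>2"
        using t assms(1) by (intro A) (auto simp: abs_mult mult_le_cancel_right1)
      finally show "Re (iexp (- (t * b)) * char M (t * T)) \<le> A / (1 + t * T)\<^sup>2"
        using t assms(1) by simp
    qed (use t in auto)
    also have "\<dots> \<le> 2 * (A / (1 + t * T)\<^sup>2)"
      using t A0 by (intro mult_right_mono) auto
    finally show "(\<integral>x. ?k t x \<partial>M) \<le> 2 * A * (1 / (1 + t * T)\<^sup>2)" by simp
  qed (rule sw(3), auto)
  also have "\<dots> = 2 * A / (1 + T)"
    using assms(1) by (subst set_integral_inverse_square) auto
  also have "\<dots> \<le> 2 * A / T"
    using assms A0 by (intro divide_left_mono) auto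
  finally show "expectation (\<lambda>x. fejer_kernel (T * x - b)) \<le> 2 * A / T" .
qed

lemma (in real_distribution) expectation_smooth_sgn:
  assumes [simp]: "integrable M (\<lambda>x. x)"
  shows "integrable M (\<lambda>x. smooth_sgn (T * x - b))"
    and "expectation (\<lambda>x. smooth_sgn (T * x - b))
       = 2 / pi * (LBINT t:{0..1}. (1 - t\<^sup>2) / t * Im (iexp (- (t * b)) * char M (t * T)))"
    and "set_integrable lborel {0..1} (\<lambda>t. (1 - t\<^sup>2) / t * Im (iexp (- (t * b)) * char M (t * T)))"
proof -
  let ?k = "\<lambda>t x. (1 - t\<^sup>2) * sin (t * (T * x - b)) / t"
  have k: "(\<lambda>(t, x). ?k t x) \<in> borel_measurable (borel \<Otimes>\<^sub>M borel)"
    by measurable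
  note sw = integral_swap_unit_interval[of ?k "\<lambda>x. \<bar>T * x - b\<bar>", OF k abs_sin_div_le]
  have *: "(\<integral>x. ?k t x \<partial>M) = (1 - t\<^sup>2) / t * Im (iexp (- (t * b)) * char M (t * T))" for t
    unfolding integral_cos_sin_char(2)[symmetric] by simp
  show "integrable M (\<lambda>x. smooth_sgn (T * x - b))"
    unfolding smooth_sgn_def by (intro integrable_mult_right sw(1)) auto
  show "expectation (\<lambda>x. smooth_sgn (T * x - b))
       = 2 / pi * (LBINT t:{0..1}. (1 - t\<^sup>2) / t * Im (iexp (- (t * b)) * char M (t * T)))"
    unfolding *[symmetric] smooth_sgn_def by (subst sw(2)[symmetric]) auto
  show "set_integrable lborel {0..1} (\<lambda>t. (1 - t\<^sup>2) / t * Im (iexp (- (t * b)) * char M (t * T)))"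
    unfolding *[symmetric] by (rule sw(3)) auto
qed

text \<open>
  Rescale by $T$. Replacing the indicator of the half-line by the sign approximation costs the expectation of two Fejer
  kernels, which is $O(A/T)$ because $A/(1+|t|)^2$ is integrable. The expectations of the sign
  approximation differ by the integral of the difference of the characteristic functions divided by $t$; the weight
  $|t|/(1+|t|)^2$ makes this integral at most $\epsilon$, uniformly in $T$.
\<close>

theorem smoothing_inequality:
  fixes \<mu> \<nu> :: "real measure"
  assumes "real_distribution \<mu>" "real_distribution \<nu>"
    and int: "integrable \<mu> (\<lambda>x. x)" "integrable \<nu> (\<lambda>x. x)"
    and T: "0 < T"
    and close: "\<And>t. \<bar>t\<bar> \<le> T \<Longrightarrow> cmod (char \<mu> t - char \<nu> t) \<le> \<epsilon> * \<bar>t\<bar> / (1 + \<bar>t\<bar>)\<^sup>2"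
    and A: "\<And>t. \<bar>t\<bar> \<le> T \<Longrightarrow> cmod (char \<mu> t) \<le> A / (1 + \<bar>t\<bar>)\<^sup>2"
           "\<And>t. \<bar>t\<bar> \<le> T \<Longrightarrow> cmod (char \<nu> t) \<le> A / (1 + \<bar>t\<bar>)\<^sup>2"
  shows "\<bar>measure \<mu> {a<..} - measure \<nu> {a<..}\<bar> \<le> \<epsilon> + 36 * A / T"
proof -
  interpret \<mu>: real_distribution \<mu> by fact
  interpret \<nu>: real_distribution \<nu> by fact
  define b where "b = T * a"
  have eps: "0 \<le> \<epsilon>"
    using order_trans[OF norm_ge_zero close[of T]] T by (auto simp: zero_le_divide_iff zero_le_mult_iff)
  have approx: "\<bar>2 * measure M {a<..} - 1 - (\<integral>x. smooth_sgn (T * x - b) \<partial>M)\<bar> \<le> 36 * A / T"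
    if "real_distribution M" "integrable M (\<lambda>x. x)"
      and A: "\<And>t. \<bar>t\<bar> \<le> T \<Longrightarrow> cmod (char M t) \<le> A / (1 + \<bar>t\<bar>)\<^sup>2" for M
  proof -
    interpret M: real_distribution M by fact
    note F = M.expectation_fejer_kernel[OF T A]
    have shift: "T * x - b + pi = T * x - (b - pi)" for x by simp
    have i1: "integrable M (\<lambda>x. indicator {a<..} x :: real)"
      by (rule M.integrable_const_bound[where B = 1]) (auto simp: indicator_def)
    have ind: "(indicator {0<..} (T * x - b) :: real) = indicator {a<..} x" for x
      using T by (auto simp: indicator_def b_def)
    have "2 * measure M {a<..} - 1 - (\<integral>x. smooth_sgn (T * x - b) \<partial>M)
       = (\<integral>x. 2 * indicator {a<..} x - 1 - smooth_sgn (T * x - b) \<partial>M)"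
      using i1 M.expectation_smooth_sgn(1)[OF that(2), of T b] using M.prob_space by simp
    also have "\<bar>\<dots>\<bar> \<le> (\<integral>x. 9 * (fejer_kernel (T * x - b) + fejer_kernel (T * x - (b - pi))) \<partial>M)"
      unfolding real_norm_def[symmetric]
    proof (rule norm_integral_le)
      show "norm (2 * indicator {a<..} x - 1 - smooth_sgn (T * x - b))
          \<le> 9 * (fejer_kernel (T * x - b) + fejer_kernel (T * x - (b - pi)))" for x
        using indicator_approx_smooth_sgn[of "T * x - b"] unfolding shift ind by simp
    qed (use i1 F(1) M.expectation_smooth_sgn(1)[OF that(2), of T b] in auto)
    also have "\<dots> = 9 * ((\<integral>x. fejer_kernel (T * x - b) \<partial>M) + (\<integral>x. fejer_kernel (T * x - (b - pi)) \<partial>M))"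
      using F(1) by simp
    also have "\<dots> \<le> 9 * (2 * A / T + 2 * A / T)"
      by (intro mult_left_mono add_mono F(2)) auto
    finally show ?thesis by simp
  qed
  let ?h = "\<lambda>M t. (1 - t\<^sup>2) / t * Im (iexp (- (t * b)) * char M (t * T))"
  have diff: "\<bar>(\<integral>x. smooth_sgn (T * x - b) \<partial>\<mu>) - (\<integral>x. smooth_sgn (T * x - b) \<partial>\<nu>)\<bar>
     = 2 / pi * \<bar>LBINT t:{0..1}. ?h \<mu> t - ?h \<nu> t\<bar>"
    unfolding \<mu>.expectation_smooth_sgn(2)[OF int(1)] \<nu>.expectation_smooth_sgn(2)[OF int(2)]
    by (subst set_integral_diff(2)[OF \<mu>.expectation_smooth_sgn(3)[OF int(1)]
       \<nu>.expectation_smooth_sgn(3)[OF int(2)]])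
       (simp only: right_diff_distrib[symmetric] abs_mult, simp)
  have "\<bar>LBINT t:{0..1}. ?h \<mu> t - ?h \<nu> t\<bar> \<le> (LBINT t:{0..1}. \<epsilon> * T * (1 / (1 + t * T)\<^sup>2))"
    unfolding set_lebesgue_integral_def real_norm_def[symmetric]
  proof (rule norm_integral_le)
    show "integrable lborel (\<lambda>t. indicat_real {0..1::real} t *\<^sub>R (\<epsilon> * T * (1 / (1 + t * T)\<^sup>2)))"
      using set_integral_inverse_square(1)[of T "\<epsilon> * T"] T unfolding set_integrable_def by simp
    have "norm (?h \<mu> t - ?h \<nu> t) \<le> \<epsilon> * T * (1 / (1 + t * T)\<^sup>2)" if t: "t \<in> {0..1}" for t
    proof (cases "t = 0")
      case True
      then show ?thesis using eps T by simp
    next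
      case False
      then have t: "0 < t" "t \<le> 1" using t by auto
      have "?h \<mu> t - ?h \<nu> t = (1 - t\<^sup>2) / t * Im (iexp (- (t * b)) * (char \<mu> (t * T) - char \<nu> (t * T)))"
        by (simp only: right_diff_distrib minus_complex.sel)
      also have "norm \<dots> \<le> 1 / t * cmod (iexp (- (t * b)) * (char \<mu> (t * T) - char \<nu> (t * T)))"
        unfolding norm_mult[of "_ / _"] using t abs_Im_le_cmod
        by (intro mult_mono) (auto simp: divide_right_mono power_le_one simp del: times_complex.sel)
      also have "\<dots> = 1 / t * cmod (char \<mu> (t * T) - char \<nu> (t * T))"
        by (simp only: norm_mult norm_exp_i_times mult_1)
      also have "\<dots> \<le> 1 / t * (\<epsilon> * \<bar>t * T\<bar> / (1 + \<bar>t * T\<bar>)\<^sup>2)"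
        using t T by (intro mult_left_mono close) (auto simp: abs_mult mult_le_cancel_right1)
      finally show ?thesis using t T by (simp add: abs_mult)
    qed
    then show "norm (indicat_real {0..1::real} t *\<^sub>R (?h \<mu> t - ?h \<nu> t))
        \<le> indicat_real {0..1::real} t *\<^sub>R (\<epsilon> * T * (1 / (1 + t * T)\<^sup>2))" for t
      by (auto simp: indicator_def)
  qed
  also have "\<dots> = \<epsilon> * (T / (1 + T))"
    using T by (subst set_integral_inverse_square(2)) auto
  also have "\<dots> \<le> \<epsilon> * 1"
    using T eps by (intro mult_left_mono) auto
  finally have "\<bar>(\<integral>x. smooth_sgn (T * x - b) \<partial>\<mu>) - (\<integral>x. smooth_sgn (T * x - b) \<partial>\<nu>)\<bar> \<le> 2 / pi * \<epsilon>"
    unfolding diff by (intro mult_left_mono) auto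
  also have "\<dots> \<le> 1 * \<epsilon>"
    using eps pi_gt3 by (intro mult_right_mono) auto
  finally show ?thesis
    using approx[OF assms(1) int(1) A(1)] approx[OF assms(2) int(2) A(2)] eps by linarith
qed

section \<open>Moments and tilted characteristic functions\<close>

text \<open>
  The laws considered in the theorem. The estimates have constants that do not depend on $\rho$.
\<close>

locale standard_subgaussian = real_distribution \<rho> for \<rho> :: "real measure" +
  assumes integrable_id: "integrable \<rho> (\<lambda>x. x)" and mean_0: "(LINT x|\<rho>. x) = 0"
    and integrable_square: "integrable \<rho> (\<lambda>x. x\<^sup>2)" and variance_1: "(LINT x|\<rho>. x\<^sup>2) = 1"
    and integrable_exp: "\<And>t. integrable \<rho> (\<lambda>x. exp (t * x))"
    and mgf_le: "\<And>t. (LINT x|\<rho>. exp (t * x)) \<le> exp (t\<^sup>2 / 2)"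
begin

definition mgf :: "real \<Rightarrow> real" where
  "mgf t = (LINT x|\<rho>. exp (t * x))"

text \<open>
  The characteristic function of $X - \theta$ under the tilted law $e^{\theta x} \rho(dx)/M(\theta)$. The point of
  reference is $\theta$ and not the mean of the tilted law, which differs from it by $O(\theta^2)$; the resulting
  error is harmless and the comparison is then with the fixed standard normal law.
\<close>

definition tilted_char :: "real \<Rightarrow> real \<Rightarrow> complex" where
  "tilted_char \<theta> s = (CLINT x|\<rho>. exp (\<theta> * x) *\<^sub>R iexp (s * (x - \<theta>))) / mgf \<theta>"

end

lemma power_le_fact_exp: "x ^ k \<le> fact k * exp x" if "0 \<le> x" for x :: real
proof -
  have "(\<Sum>n\<in>{k}. inverse (fact n) *\<^sub>R x ^ n) \<le> (\<Sum>n. inverse (fact n) *\<^sub>R x ^ n)"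
    using that by (intro sum_le_suminf summable_exp_generic) auto
  then show ?thesis
    by (simp add: exp_def field_simps)
qed

lemma exp_2_le: "exp 2 \<le> (15/2 :: real)"
proof -
  have "exp (1::real) \<le> 2.72"
    using e_approx_32 by (simp add: abs_if split: if_splits)
  then have "exp (1::real) ^ 2 \<le> 2.72 ^ 2"
    by (intro power_mono) auto
  then show ?thesis
    by (simp add: exp_double[symmetric] power2_eq_square flip: exp_add)
qed

context standard_subgaussian
begin

text \<open>
  All moments are controlled by the generating function at $\pm 2$, because $|x|^k \le k!\, e^{|x|}$.
\<close>

lemma power_exp_abs:
  shows integrable_power_exp_abs: "integrable \<rho> (\<lambda>x. \<bar>x\<bar> ^ k * exp \<bar>x\<bar>)"
    and expectation_power_exp_abs: "expectation (\<lambda>x. \<bar>x\<bar> ^ k * exp \<bar>x\<bar>) \<le> 15 * fact k"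
proof -
  have le: "\<bar>x\<bar> ^ k * exp \<bar>x\<bar> \<le> fact k * (exp (2 * x) + exp ((-2) * x))" for x :: real
  proof -
    have "\<bar>x\<bar> ^ k * exp \<bar>x\<bar> \<le> (fact k * exp \<bar>x\<bar>) * exp \<bar>x\<bar>"
      by (intro mult_right_mono power_le_fact_exp) auto
    also have "\<dots> = fact k * exp (2 * \<bar>x\<bar>)"
      by (simp flip: exp_add)
    also have "exp (2 * \<bar>x\<bar>) \<le> exp (2 * x) + exp ((-2) * x)"
      by (cases "0 \<le> x") auto
    finally show ?thesis by simp
  qed
  have int: "integrable \<rho> (\<lambda>x. fact k * (exp (2 * x) + exp ((-2) * x)))"
    using integrable_exp[of 2] integrable_exp[of "-2"] by auto
  then show *: "integrable \<rho> (\<lambda>x. \<bar>x\<bar> ^ k * exp \<bar>x\<bar>)"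
    by (rule Bochner_Integration.integrable_bound) (use le in \<open>auto intro!: AE_I2 order_trans[OF le]\<close>)
  have "expectation (\<lambda>x. \<bar>x\<bar> ^ k * exp \<bar>x\<bar>) \<le> expectation (\<lambda>x. fact k * (exp (2 * x) + exp ((-2) * x)))"
    by (intro integral_mono * int le)
  also have "\<dots> = fact k * (expectation (\<lambda>x. exp (2 * x)) + expectation (\<lambda>x. exp ((-2) * x)))"
    using integrable_exp[of 2] integrable_exp[of "-2"] by simp
  also have "\<dots> \<le> fact k * (exp 2 + exp 2)"
    using mgf_le[of 2] mgf_le[of "-2"] by (intro mult_left_mono add_mono) auto
  also have "\<dots> \<le> fact k * 15"
    using exp_2_le by (intro mult_left_mono) auto
  finally show "expectation (\<lambda>x. \<bar>x\<bar> ^ k * exp \<bar>x\<bar>) \<le> 15 * fact k" by simp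
qed

lemma cubic_exp_bound:
  fixes f :: "real \<Rightarrow> 'b :: {banach, second_countable_topology}"
  assumes [measurable]: "f \<in> borel_measurable borel"
    and le: "\<And>x. norm (f x) \<le> (a3 * \<bar>x\<bar> ^ 3 + a2 * \<bar>x\<bar> ^ 2 + a1 * \<bar>x\<bar> + a0) * exp \<bar>x\<bar>"
    and nonneg: "0 \<le> a0" "0 \<le> a1" "0 \<le> a2" "0 \<le> a3"
  shows "integrable \<rho> f" and "norm (expectation f) \<le> 15 * (6 * a3 + 2 * a2 + a1 + a0)"
proof -
  let ?g = "\<lambda>x. a3 * (\<bar>x\<bar> ^ 3 * exp \<bar>x\<bar>) + a2 * (\<bar>x\<bar> ^ 2 * exp \<bar>x\<bar>) + a1 * (\<bar>x\<bar> ^ 1 * exp \<bar>x\<bar>) + a0 * (\<bar>x\<bar> ^ 0 * exp \<bar>x\<bar>)"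
  have int: "integrable \<rho> ?g"
    by (intro Bochner_Integration.integrable_add integrable_mult_right integrable_power_exp_abs)
  have le': "norm (f x) \<le> ?g x" for x
    using le[of x] by (simp add: algebra_simps)
  show "integrable \<rho> f"
  proof (rule Bochner_Integration.integrable_bound[OF int _ AE_I2])
    show "norm (f x) \<le> norm (?g x)" for x
      unfolding real_norm_def by (rule order_trans[OF le'[of x] abs_ge_self])
  qed simp
  have "norm (expectation f) \<le> expectation ?g"
    by (intro norm_integral_le int le')
  also have "\<dots> = a3 * expectation (\<lambda>x. \<bar>x\<bar> ^ 3 * exp \<bar>x\<bar>) + a2 * expectation (\<lambda>x. \<bar>x\<bar> ^ 2 * exp \<bar>x\<bar>)
      + a1 * expectation (\<lambda>x. \<bar>x\<bar> ^ 1 * exp \<bar>x\<bar>) + a0 * expectation (\<lambda>x. \<bar>x\<bar> ^ 0 * exp \<bar>x\<bar>)"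
    using integrable_power_exp_abs[of 3] integrable_power_exp_abs[of 2] integrable_power_exp_abs[of 1] integrable_power_exp_abs[of 0]
    by simp
  also have "\<dots> \<le> a3 * (15 * fact 3) + a2 * (15 * fact 2) + a1 * (15 * fact 1) + a0 * (15 * fact 0)"
    using nonneg by (intro add_mono mult_left_mono expectation_power_exp_abs)
  also have "\<dots> = 15 * (6 * a3 + 2 * a2 + a1 + a0)"
    by (simp add: fact_numeral)
  finally show "norm (expectation f) \<le> 15 * (6 * a3 + 2 * a2 + a1 + a0)" .
qed

end

lemma real_exp_Taylor:
  fixes y :: real
  shows "\<bar>exp y - 1\<bar> \<le> exp \<bar>y\<bar> * \<bar>y\<bar>"
    and "\<bar>exp y - (1 + y)\<bar> \<le> exp \<bar>y\<bar> * \<bar>y\<bar> ^ 2"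
    and "\<bar>exp y - (1 + y + y\<^sup>2 / 2)\<bar> \<le> exp \<bar>y\<bar> * \<bar>y\<bar> ^ 3 / 2"
proof -
  have *: "\<bar>exp y - (\<Sum>k\<le>n. y ^ k / fact k)\<bar> \<le> exp \<bar>y\<bar> * \<bar>y\<bar> ^ Suc n / fact n" for n
  proof -
    have "cmod (complex_of_real (exp y - (\<Sum>k\<le>n. y ^ k / fact k)))
      = cmod (exp (complex_of_real y) - (\<Sum>k\<le>n. complex_of_real y ^ k / fact k))"
      by (simp add: exp_of_real)
    also have "\<dots> \<le> exp \<bar>Re (complex_of_real y)\<bar> * cmod (complex_of_real y) ^ Suc n / fact n"
      by (rule Taylor_exp)
    finally show ?thesis by (simp only: norm_of_real Re_complex_of_real)
  qed
  show "\<bar>exp y - 1\<bar> \<le> exp \<bar>y\<bar> * \<bar>y\<bar>"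
    using *[of 0] by simp
  show "\<bar>exp y - (1 + y)\<bar> \<le> exp \<bar>y\<bar> * \<bar>y\<bar> ^ 2"
    using *[of 1] by (simp add: power2_eq_square)
  show "\<bar>exp y - (1 + y + y\<^sup>2 / 2)\<bar> \<le> exp \<bar>y\<bar> * \<bar>y\<bar> ^ 3 / 2"
    using *[of 2] by (simp add: numeral_2_eq_2 numeral_3_eq_3)
qed

context standard_subgaussian
begin

lemma mgf_bounds: "1 \<le> mgf t" "mgf t \<le> exp (t\<^sup>2 / 2)"
proof -
  have "expectation (\<lambda>x. 1 + t * x) \<le> mgf t"
    unfolding mgf_def using integrable_id integrable_exp[of t]
    by (intro integral_mono) auto
  moreover have "expectation (\<lambda>x. 1 + t * x) = 1"
    using integrable_id mean_0 prob_space by simp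
  ultimately show "1 \<le> mgf t" by simp
qed (simp add: mgf_def mgf_le)

text \<open>
  For $|t| \le 1$, expand $e^{tx}$ to second order; mean $0$ and variance $1$ give $M(t) \ge 1 + t^2/2 - 45 |t|^3$. For
  $|t| > 1$ the left-hand side is negative.
\<close>

lemma mgf_lower: "1 - 46 * \<bar>t\<bar> ^ 3 \<le> mgf t * exp (- t\<^sup>2 / 2)"
proof (cases "\<bar>t\<bar> \<le> 1")
  case False
  then have "1 \<le> \<bar>t\<bar> ^ 3" by (intro one_le_power) auto
  then show ?thesis
    using mult_nonneg_nonneg[of "mgf t" "exp (- t\<^sup>2 / 2)"] mgf_bounds(1)[of t] exp_ge_zero[of "- t\<^sup>2 / 2"]
    by linarith
next
  case True
  let ?f = "\<lambda>x. exp (t * x) - (1 + t * x + (t * x)\<^sup>2 / 2)"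
  have b: "norm (?f x) \<le> (\<bar>t\<bar> ^ 3 / 2 * \<bar>x\<bar> ^ 3 + 0 * \<bar>x\<bar> ^ 2 + 0 * \<bar>x\<bar> + 0) * exp \<bar>x\<bar>" for x
  proof -
    have "norm (?f x) \<le> exp \<bar>t * x\<bar> * \<bar>t * x\<bar> ^ 3 / 2"
      using real_exp_Taylor(3)[of "t * x"] by simp
    also have "\<dots> \<le> exp \<bar>x\<bar> * \<bar>t * x\<bar> ^ 3 / 2"
      using True by (intro divide_right_mono mult_right_mono) (auto simp: abs_mult mult_left_le_one_le)
    finally show ?thesis by (simp add: abs_mult power_mult_distrib mult_ac)
  qed
  note cb = cubic_exp_bound[of ?f "\<bar>t\<bar> ^ 3 / 2" 0 0 0, OF _ b]
  have "expectation ?f = mgf t - (1 + t\<^sup>2 / 2)"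
    using integrable_exp[of t] integrable_id integrable_square mean_0 variance_1 prob_space
    by (simp add: mgf_def power_mult_distrib)
  then have "1 + t\<^sup>2 / 2 - 45 * \<bar>t\<bar> ^ 3 \<le> mgf t"
    using cb(2) by simp
  then have 1: "(1 + t\<^sup>2 / 2 - 45 * \<bar>t\<bar> ^ 3) * exp (- t\<^sup>2 / 2) \<le> mgf t * exp (- t\<^sup>2 / 2)"
    by (intro mult_right_mono) auto
  have t4: "t ^ 4 \<le> \<bar>t\<bar> ^ 3"
    using True power_decreasing[of 3 4 "\<bar>t\<bar>"] by simp
  have "1 - (t\<^sup>2 / 2) \<le> exp (- (t\<^sup>2 / 2))"
    using exp_ge_add_one_self[of "- (t\<^sup>2 / 2)"] by simp
  then have "(1 + t\<^sup>2 / 2) * (1 - t\<^sup>2 / 2) \<le> (1 + t\<^sup>2 / 2) * exp (- t\<^sup>2 / 2)"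
    by (intro mult_left_mono) auto
  then have "1 - t ^ 4 / 4 \<le> (1 + t\<^sup>2 / 2) * exp (- t\<^sup>2 / 2)"
    by (simp add: algebra_simps power2_eq_square power4_eq_xxxx)
  moreover have "45 * \<bar>t\<bar> ^ 3 * exp (- t\<^sup>2 / 2) \<le> 45 * \<bar>t\<bar> ^ 3 * 1"
    by (intro mult_left_mono) auto
  ultimately show ?thesis
    using 1 t4 zero_le_power[of "\<bar>t\<bar>" 3] unfolding left_diff_distrib distrib_right by linarith
qed

lemma mgf_power_lower: "1 - 46 * real n * \<bar>t\<bar> ^ 3 \<le> mgf t ^ n * exp (- real n * t\<^sup>2 / 2)"
proof -
  have pos: "0 \<le> mgf t * exp (- t\<^sup>2 / 2)"
    using mgf_bounds(1)[of t] by simp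
  have "1 + real n * (mgf t * exp (- t\<^sup>2 / 2) - 1) \<le> (1 + (mgf t * exp (- t\<^sup>2 / 2) - 1)) ^ n"
    using pos by (intro Bernoulli_inequality) simp
  also have "\<dots> = mgf t ^ n * exp (- real n * t\<^sup>2 / 2)"
    by (simp add: power_mult_distrib flip: exp_of_nat_mult)
  finally have "1 + real n * (mgf t * exp (- t\<^sup>2 / 2) - 1) \<le> mgf t ^ n * exp (- real n * t\<^sup>2 / 2)" .
  moreover have "real n * (- 46 * \<bar>t\<bar> ^ 3) \<le> real n * (mgf t * exp (- t\<^sup>2 / 2) - 1)"
    using mgf_lower[of t] by (intro mult_left_mono) auto
  ultimately show ?thesis by simp
qed

text \<open>
  Expand $e^{is(X-\theta)}$ to second order under the tilted law. The first moment $E[(X-\theta)e^{\theta X}]$ is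
  $O(\theta^2)$, since its first-order part $E[(X-\theta)(1+\theta X)]$ vanishes by the normalisation of $\rho$; the second
  moment is $M(\theta) + O(\theta)$. Dividing by $M(\theta) \ge 1$ only decreases the error.
\<close>

lemma tilted_char_Taylor:
  assumes "0 \<le> \<theta>" "\<theta> \<le> 1"
  shows "cmod (tilted_char \<theta> s - (1 - s\<^sup>2 / 2)) \<le> 120 * \<theta>\<^sup>2 * \<bar>s\<bar> + 75 * \<theta> * s\<^sup>2 + 40 * \<bar>s\<bar> ^ 3"
proof -
  have exp_le: "exp \<bar>\<theta> * x\<bar> \<le> exp \<bar>x\<bar>" for x
    using mult_right_mono[OF assms(2), of "\<bar>x\<bar>"] assms(1) by (simp add: abs_mult)
  then have exp_le': "exp (\<theta> * x) \<le> exp \<bar>x\<bar>" for x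
    by (meson abs_ge_self exp_le_cancel_iff order_trans)
  have abs_mult_\<theta>: "\<bar>\<theta> * x\<bar> = \<theta> * \<bar>x\<bar>" for x
    using assms by (simp add: abs_mult)
  have abs_le: "\<bar>x - \<theta>\<bar> \<le> \<bar>x\<bar> + 1" for x
    using assms by linarith
  define m1 where "m1 = expectation (\<lambda>x. (x - \<theta>) * exp (\<theta> * x))"
  define m2 where "m2 = expectation (\<lambda>x. (x - \<theta>)\<^sup>2 * exp (\<theta> * x))"
  let ?f1 = "\<lambda>x. (x - \<theta>) * (exp (\<theta> * x) - (1 + \<theta> * x))"
  let ?f2 = "\<lambda>x. ((x - \<theta>)\<^sup>2 - 1) * exp (\<theta> * x) - (x\<^sup>2 - 1)"
  let ?f3 = "\<lambda>x. exp (\<theta> * x) *\<^sub>R (iexp (s * (x - \<theta>)) - (\<Sum>k\<le>2. (\<i> * complex_of_real (s * (x - \<theta>))) ^ k / fact k))"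
  have i1: "integrable \<rho> (\<lambda>x. (x - \<theta>) * exp (\<theta> * x))"
  proof (rule cubic_exp_bound(1)[of _ 0 0 1 1])
    show "norm ((x - \<theta>) * exp (\<theta> * x)) \<le> (0 * \<bar>x\<bar> ^ 3 + 0 * \<bar>x\<bar> ^ 2 + 1 * \<bar>x\<bar> + 1) * exp \<bar>x\<bar>" for x
      using mult_mono[OF abs_le[of x] exp_le'[of x]] by (simp add: abs_mult)
  qed auto
  have i2: "integrable \<rho> (\<lambda>x. (x - \<theta>)\<^sup>2 * exp (\<theta> * x))"
  proof (rule cubic_exp_bound(1)[of _ 0 1 2 1])
    have "(x - \<theta>)\<^sup>2 \<le> (\<bar>x\<bar> + 1)\<^sup>2" for x
      using power_mono[OF abs_le[of x], of 2] by simp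
    then show "norm ((x - \<theta>)\<^sup>2 * exp (\<theta> * x)) \<le> (0 * \<bar>x\<bar> ^ 3 + 1 * \<bar>x\<bar> ^ 2 + 2 * \<bar>x\<bar> + 1) * exp \<bar>x\<bar>" for x
      using mult_mono[OF _ exp_le'[of x], of "(x - \<theta>)\<^sup>2" "(\<bar>x\<bar> + 1)\<^sup>2"]
      by (simp add: abs_mult power2_sum add_ac)
  qed auto
  have b1: "norm (?f1 x) \<le> (\<theta>\<^sup>2 * \<bar>x\<bar> ^ 3 + \<theta>\<^sup>2 * \<bar>x\<bar> ^ 2 + 0 * \<bar>x\<bar> + 0) * exp \<bar>x\<bar>" for x
  proof -
    have "norm (?f1 x) = \<bar>x - \<theta>\<bar> * \<bar>exp (\<theta> * x) - (1 + \<theta> * x)\<bar>"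
      by (simp add: abs_mult)
    also have "\<dots> \<le> (\<bar>x\<bar> + 1) * (exp \<bar>x\<bar> * \<bar>\<theta> * x\<bar> ^ 2)"
    proof (rule mult_mono)
      show "\<bar>exp (\<theta> * x) - (1 + \<theta> * x)\<bar> \<le> exp \<bar>x\<bar> * \<bar>\<theta> * x\<bar> ^ 2"
        by (rule order_trans[OF real_exp_Taylor(2) mult_right_mono[OF exp_le]]) simp
    qed (use abs_le in auto)
    also have "\<dots> = (\<theta>\<^sup>2 * \<bar>x\<bar> ^ 3 + \<theta>\<^sup>2 * \<bar>x\<bar> ^ 2 + 0 * \<bar>x\<bar> + 0) * exp \<bar>x\<bar>"
    proof -
      have "(a + 1) * (e * (\<theta> * a) ^ 2) = (\<theta>\<^sup>2 * a ^ 3 + \<theta>\<^sup>2 * a ^ 2 + 0 * a + 0) * e" for a e :: real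
        by (simp add: algebra_simps power2_eq_square power3_eq_cube)
      then show ?thesis unfolding abs_mult_\<theta> .
    qed
    finally show ?thesis .
  qed
  have "expectation ?f1 = m1 - expectation (\<lambda>x. x + \<theta> * x\<^sup>2 - \<theta> - \<theta>\<^sup>2 * x)"
  proof -
    have "?f1 = (\<lambda>x. (x - \<theta>) * exp (\<theta> * x) - (x + \<theta> * x\<^sup>2 - \<theta> - \<theta>\<^sup>2 * x))"
      by (simp add: fun_eq_iff right_diff_distrib) (simp add: algebra_simps power2_eq_square)
    then show ?thesis
      unfolding m1_def using i1 integrable_id integrable_square
      by (simp only:) (rule Bochner_Integration.integral_diff, auto)
  qed
  also have "expectation (\<lambda>x. x + \<theta> * x\<^sup>2 - \<theta> - \<theta>\<^sup>2 * x) = 0"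
    using integrable_id integrable_square mean_0 variance_1 prob_space by simp
  finally have m1: "\<bar>m1\<bar> \<le> 120 * \<theta>\<^sup>2"
    using cubic_exp_bound(2)[of ?f1 "\<theta>\<^sup>2" "\<theta>\<^sup>2" 0 0, OF _ b1] by simp
  have b2: "norm (?f2 x) \<le> (\<theta> * \<bar>x\<bar> ^ 3 + 0 * \<bar>x\<bar> ^ 2 + 3 * \<theta> * \<bar>x\<bar> + \<theta>) * exp \<bar>x\<bar>" for x
  proof -
    have "?f2 x = \<theta> * (\<theta> - 2 * x) * exp (\<theta> * x) + (x\<^sup>2 - 1) * (exp (\<theta> * x) - 1)"
      by (simp add: algebra_simps power2_eq_square)
    also have "norm \<dots> \<le> norm (\<theta> * (\<theta> - 2 * x) * exp (\<theta> * x)) + norm ((x\<^sup>2 - 1) * (exp (\<theta> * x) - 1))"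
      by (rule norm_triangle_ineq)
    also have "\<dots> = \<theta> * \<bar>\<theta> - 2 * x\<bar> * exp (\<theta> * x) + \<bar>x\<^sup>2 - 1\<bar> * \<bar>exp (\<theta> * x) - 1\<bar>"
      using assms by (simp add: abs_mult)
    also have "\<dots> \<le> \<theta> * (1 + 2 * \<bar>x\<bar>) * exp \<bar>x\<bar> + (x\<^sup>2 + 1) * (exp \<bar>x\<bar> * \<bar>\<theta> * x\<bar>)"
    proof (rule add_mono; rule mult_mono)
      show "\<bar>exp (\<theta> * x) - 1\<bar> \<le> exp \<bar>x\<bar> * \<bar>\<theta> * x\<bar>"
        by (rule order_trans[OF real_exp_Taylor(1) mult_right_mono[OF exp_le]]) simp
      have "\<bar>\<theta> - 2 * x\<bar> \<le> 1 + 2 * \<bar>x\<bar>"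
        using assms by linarith
      then show "\<theta> * \<bar>\<theta> - 2 * x\<bar> \<le> \<theta> * (1 + 2 * \<bar>x\<bar>)"
        using assms by (intro mult_left_mono) auto
      show "\<bar>x\<^sup>2 - 1\<bar> \<le> x\<^sup>2 + 1"
        by (rule order_trans[OF abs_triangle_ineq4]) simp
    qed (use assms exp_le' in auto)
    also have "\<dots> = (\<theta> * \<bar>x\<bar> ^ 3 + 0 * \<bar>x\<bar> ^ 2 + 3 * \<theta> * \<bar>x\<bar> + \<theta>) * exp \<bar>x\<bar>"
    proof -
      have "\<theta> * (1 + 2 * a) * e + (a\<^sup>2 + 1) * (e * (\<theta> * a)) = (\<theta> * a ^ 3 + 0 * a ^ 2 + 3 * \<theta> * a + \<theta>) * e" for a e :: real
        by (simp add: algebra_simps power2_eq_square power3_eq_cube)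
      from this[of "\<bar>x\<bar>"] show ?thesis unfolding abs_mult_\<theta> power2_abs .
    qed
    finally show ?thesis .
  qed
  have "expectation ?f2 = m2 - mgf \<theta> - expectation (\<lambda>x. x\<^sup>2 - 1)"
  proof -
    have "?f2 = (\<lambda>x. ((x - \<theta>)\<^sup>2 * exp (\<theta> * x) - exp (\<theta> * x)) - (x\<^sup>2 - 1))"
      by (simp add: fun_eq_iff left_diff_distrib)
    then show ?thesis
      unfolding m2_def mgf_def
      by (simp only: Bochner_Integration.integral_diff Bochner_Integration.integrable_diff i2
        integrable_exp integrable_square integrable_const)
  qed
  also have "expectation (\<lambda>x. x\<^sup>2 - 1) = 0"
    using integrable_square variance_1 prob_space by simp
  finally have m2: "\<bar>m2 - mgf \<theta>\<bar> \<le> 150 * \<theta>"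
    using cubic_exp_bound(2)[of ?f2 \<theta> 0 "3 * \<theta>" \<theta>, OF _ b2] assms by simp
  have b3: "norm (?f3 x) \<le> (\<bar>s\<bar> ^ 3 / 6 * \<bar>x\<bar> ^ 3 + \<bar>s\<bar> ^ 3 / 2 * \<bar>x\<bar> ^ 2 + \<bar>s\<bar> ^ 3 / 2 * \<bar>x\<bar> + \<bar>s\<bar> ^ 3 / 6) * exp \<bar>x\<bar>" for x
  proof -
    have "norm (?f3 x) \<le> exp \<bar>x\<bar> * (\<bar>s * (x - \<theta>)\<bar> ^ Suc 2 / fact (Suc 2))"
      unfolding norm_scaleR using exp_le' by (intro mult_mono iexp_approx1) auto
    also have "\<dots> = exp \<bar>x\<bar> * (\<bar>s\<bar> ^ 3 * \<bar>x - \<theta>\<bar> ^ 3 / 6)"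
    proof -
      have "Suc 2 = 3" "fact 3 = (6 :: real)"
        by (simp_all add: fact_numeral)
      then show ?thesis
        by (simp only: abs_mult power_mult_distrib times_divide_eq_right)
    qed
    also have "\<dots> \<le> exp \<bar>x\<bar> * (\<bar>s\<bar> ^ 3 * (\<bar>x\<bar> + 1) ^ 3 / 6)"
      by (intro mult_left_mono divide_right_mono power_mono abs_le) auto
    also have "\<dots> = (\<bar>s\<bar> ^ 3 / 6 * \<bar>x\<bar> ^ 3 + \<bar>s\<bar> ^ 3 / 2 * \<bar>x\<bar> ^ 2 + \<bar>s\<bar> ^ 3 / 2 * \<bar>x\<bar> + \<bar>s\<bar> ^ 3 / 6) * exp \<bar>x\<bar>"
    proof -
      have "e * (c * (a + 1) ^ 3 / 6) = (c / 6 * a ^ 3 + c / 2 * a ^ 2 + c / 2 * a + c / 6) * e" for a c e :: real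
        by (simp add: power2_eq_square power3_eq_cube algebra_simps add_divide_distrib)
      from this[of "exp \<bar>x\<bar>" "\<bar>s\<bar> ^ 3" "\<bar>x\<bar>"] show ?thesis .
    qed
    finally show ?thesis .
  qed
  note cb3 = cubic_exp_bound[of ?f3 "\<bar>s\<bar> ^ 3 / 6" "\<bar>s\<bar> ^ 3 / 2" "\<bar>s\<bar> ^ 3 / 2" "\<bar>s\<bar> ^ 3 / 6", OF _ b3]
  have int0: "integrable \<rho> (\<lambda>x. complex_of_real (exp (\<theta> * x)))"
    using integrable_exp[of \<theta>] by (intro integrable_of_real)
  have int1: "integrable \<rho> (\<lambda>x. \<i> * s * complex_of_real ((x - \<theta>) * exp (\<theta> * x)))"
    by (intro integrable_mult_right integrable_of_real i1)
  have int2: "integrable \<rho> (\<lambda>x. - (s\<^sup>2 / 2) * complex_of_real ((x - \<theta>)\<^sup>2 * exp (\<theta> * x)))"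
    by (intro integrable_mult_right integrable_of_real i2)
  have f3: "integrable \<rho> ?f3"
    by (intro cb3(1)) auto
  have split: "exp (\<theta> * x) *\<^sub>R iexp (s * (x - \<theta>)) = ?f3 x + complex_of_real (exp (\<theta> * x))
      + \<i> * s * complex_of_real ((x - \<theta>) * exp (\<theta> * x))
      + (- (s\<^sup>2 / 2) * complex_of_real ((x - \<theta>)\<^sup>2 * exp (\<theta> * x)))" for x
  proof -
    have S: "(\<Sum>k\<le>2. (\<i> * z) ^ k / fact k) = 1 + \<i> * z - z\<^sup>2 / 2" for z :: complex
      by (simp add: numeral_2_eq_2) (simp add: algebra_simps)
    have "e * I = e * (I - (1 + \<i> * (c * y) - (c * y)\<^sup>2 / 2)) + e + \<i> * c * (y * e) + (- (c\<^sup>2 / 2) * (y\<^sup>2 * e))"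
      for e I c y :: complex
      by (simp add: right_diff_distrib distrib_left power_mult_distrib mult_ac)
    from this[of "exp (\<theta> * x)" "iexp (s * (x - \<theta>))" s "x - \<theta>"] show ?thesis
      unfolding S scaleR_conv_of_real of_real_mult of_real_power of_real_minus of_real_divide of_real_numeral .
  qed
  have N: "mgf \<theta> * tilted_char \<theta> s = expectation ?f3 + mgf \<theta> + \<i> * s * m1 + (- (s\<^sup>2 / 2) * m2)"
  proof -
    have "mgf \<theta> * tilted_char \<theta> s = (CLINT x|\<rho>. exp (\<theta> * x) *\<^sub>R iexp (s * (x - \<theta>)))"
      using mgf_bounds(1)[of \<theta>] by (simp add: tilted_char_def)
    also have "\<dots> = (CLINT x|\<rho>. ?f3 x + complex_of_real (exp (\<theta> * x))
      + \<i> * s * complex_of_real ((x - \<theta>) * exp (\<theta> * x))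
      + (- (s\<^sup>2 / 2) * complex_of_real ((x - \<theta>)\<^sup>2 * exp (\<theta> * x))))"
      by (simp only: split)
    also have "\<dots> = expectation ?f3 + (CLINT x|\<rho>. complex_of_real (exp (\<theta> * x)))
      + (CLINT x|\<rho>. \<i> * s * complex_of_real ((x - \<theta>) * exp (\<theta> * x)))
      + (CLINT x|\<rho>. - (s\<^sup>2 / 2) * complex_of_real ((x - \<theta>)\<^sup>2 * exp (\<theta> * x)))"
      by (simp only: Bochner_Integration.integral_add Bochner_Integration.integrable_add f3 int0 int1 int2)
    also have "\<dots> = expectation ?f3 + mgf \<theta> + \<i> * s * m1 + (- (s\<^sup>2 / 2) * m2)"
      by (simp only: integral_mult_right_zero integral_complex_of_real mgf_def m1_def m2_def)
         (simp only: of_real_mult)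
    finally show ?thesis .
  qed
  have "mgf \<theta> * (tilted_char \<theta> s - (1 - s\<^sup>2 / 2)) = expectation ?f3 + \<i> * s * m1 - s\<^sup>2 / 2 * (m2 - mgf \<theta>)"
    unfolding right_diff_distrib[of "complex_of_real (mgf \<theta>)" "tilted_char \<theta> s"] N by (simp add: field_simps)
  also have "cmod \<dots> \<le> cmod (expectation ?f3) + cmod (\<i> * s * m1) + cmod (s\<^sup>2 / 2 * (m2 - mgf \<theta>))"
    by (meson norm_triangle_ineq norm_triangle_ineq4 order_trans add_mono order_refl)
  also have "\<dots> = cmod (expectation ?f3) + \<bar>s\<bar> * \<bar>m1\<bar> + s\<^sup>2 / 2 * \<bar>m2 - mgf \<theta>\<bar>"
    by (simp add: norm_mult norm_divide norm_power flip: of_real_diff)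
  also have "\<dots> \<le> 40 * \<bar>s\<bar> ^ 3 + \<bar>s\<bar> * (120 * \<theta>\<^sup>2) + s\<^sup>2 / 2 * (150 * \<theta>)"
    using cb3(2) m1 m2 by (intro add_mono mult_left_mono) auto
  finally have "cmod (mgf \<theta> * (tilted_char \<theta> s - (1 - s\<^sup>2 / 2)))
      \<le> 40 * \<bar>s\<bar> ^ 3 + \<bar>s\<bar> * (120 * \<theta>\<^sup>2) + s\<^sup>2 / 2 * (150 * \<theta>)" .
  then have "mgf \<theta> * cmod (tilted_char \<theta> s - (1 - s\<^sup>2 / 2)) \<le> 120 * \<theta>\<^sup>2 * \<bar>s\<bar> + 75 * \<theta> * s\<^sup>2 + 40 * \<bar>s\<bar> ^ 3"
    using mgf_bounds(1)[of \<theta>] unfolding norm_mult norm_of_real by (simp add: mult_ac add_ac)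
  moreover have "1 * cmod (tilted_char \<theta> s - (1 - s\<^sup>2 / 2)) \<le> mgf \<theta> * cmod (tilted_char \<theta> s - (1 - s\<^sup>2 / 2))"
    by (intro mult_right_mono mgf_bounds) auto
  ultimately show ?thesis by simp
qed

text \<open>
  On the range $\theta, |s| \le 1/600$ the errors $75 \theta s^2$ and $40 |s|^3$ use up less than half of the
  decrease $s^2/2$. The error $120 \theta^2 |s|$ is linear in $s$ and has to remain in the exponent.
\<close>

lemma tilted_char_bounds:
  assumes "0 \<le> \<theta>" "\<theta> \<le> 1 / 600" "\<bar>s\<bar> \<le> 1 / 600"
  shows "cmod (tilted_char \<theta> s) \<le> exp (- s\<^sup>2 / 4 + 120 * \<theta>\<^sup>2 * \<bar>s\<bar>)"
    and "cmod (tilted_char \<theta> s - complex_of_real (exp (- s\<^sup>2 / 2))) \<le> 120 * \<theta>\<^sup>2 * \<bar>s\<bar> + 75 * \<theta> * s\<^sup>2 + 41 * \<bar>s\<bar> ^ 3"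
proof -
  have T: "cmod (tilted_char \<theta> s - (1 - s\<^sup>2 / 2)) \<le> 120 * \<theta>\<^sup>2 * \<bar>s\<bar> + 75 * \<theta> * s\<^sup>2 + 40 * \<bar>s\<bar> ^ 3"
    using assms by (intro tilted_char_Taylor) auto
  have s3: "\<bar>s\<bar> ^ 3 \<le> s\<^sup>2 / 600"
    using mult_right_mono[OF assms(3), of "s\<^sup>2"] by (simp add: power3_eq_cube power2_eq_square)
  have th: "\<theta> * s\<^sup>2 \<le> s\<^sup>2 / 600"
    using mult_right_mono[OF assms(2), of "s\<^sup>2"] by simp
  have "s\<^sup>2 \<le> (1 / 600)\<^sup>2"
    using power_mono[OF assms(3), of 2] by simp
  then have s2: "s\<^sup>2 \<le> 1" by (simp add: power2_eq_square)
  have "cmod (tilted_char \<theta> s) \<le> cmod (tilted_char \<theta> s - (1 - s\<^sup>2 / 2)) + cmod (1 - s\<^sup>2 / 2)"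
    using norm_triangle_sub[of "tilted_char \<theta> s" "1 - s\<^sup>2 / 2"] by (simp add: add.commute)
  also have "cmod (1 - s\<^sup>2 / 2) = \<bar>1 - s\<^sup>2 / 2\<bar>"
    by (metis norm_of_real of_real_1 of_real_diff of_real_divide of_real_numeral of_real_power)
  also have "\<dots> = 1 - s\<^sup>2 / 2"
    using s2 by simp
  finally have "cmod (tilted_char \<theta> s) \<le> 1 + (- s\<^sup>2 / 4 + 120 * \<theta>\<^sup>2 * \<bar>s\<bar>)"
    using T assms s3 th zero_le_power2[of s] by linarith
  also have "\<dots> \<le> exp (- s\<^sup>2 / 4 + 120 * \<theta>\<^sup>2 * \<bar>s\<bar>)"
    by (rule exp_ge_add_one_self)
  finally show "cmod (tilted_char \<theta> s) \<le> exp (- s\<^sup>2 / 4 + 120 * \<theta>\<^sup>2 * \<bar>s\<bar>)" .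
  have "\<bar>exp (- (s\<^sup>2 / 2)) - (1 + - (s\<^sup>2 / 2))\<bar> \<le> exp \<bar>- (s\<^sup>2 / 2)\<bar> * \<bar>- (s\<^sup>2 / 2)\<bar> ^ 2"
    by (rule real_exp_Taylor)
  also have "\<dots> \<le> exp 1 * (s\<^sup>2 / 2) ^ 2"
    using s2 by (intro mult_mono) auto
  also have "\<dots> \<le> 3 * (s\<^sup>2 / 2) ^ 2"
    using exp_le by (intro mult_right_mono) auto
  also have "\<dots> \<le> \<bar>s\<bar> ^ 3"
  proof -
    have "\<bar>s\<bar> ^ 3 * \<bar>s\<bar> \<le> \<bar>s\<bar> ^ 3 * (1 / 600)"
      using assms by (intro mult_left_mono) auto
    moreover have "\<bar>s\<bar> ^ 3 * \<bar>s\<bar> = 4 * (s\<^sup>2 / 2) ^ 2"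
      by (cases "0 \<le> s") (auto simp: power2_eq_square power3_eq_cube)
    ultimately show ?thesis
      using zero_le_power[of "\<bar>s\<bar>" 3] by linarith
  qed
  finally have "\<bar>exp (- s\<^sup>2 / 2) - (1 - s\<^sup>2 / 2)\<bar> \<le> \<bar>s\<bar> ^ 3" by simp
  then have "cmod (complex_of_real ((1 - s\<^sup>2 / 2) - exp (- s\<^sup>2 / 2))) \<le> \<bar>s\<bar> ^ 3"
    by (simp only: norm_of_real abs_minus_commute)
  then have "cmod ((1 - s\<^sup>2 / 2) - exp (- s\<^sup>2 / 2)) \<le> \<bar>s\<bar> ^ 3"
    by simp
  then show "cmod (tilted_char \<theta> s - complex_of_real (exp (- s\<^sup>2 / 2))) \<le> 120 * \<theta>\<^sup>2 * \<bar>s\<bar> + 75 * \<theta> * s\<^sup>2 + 41 * \<bar>s\<bar> ^ 3"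
    using T assms norm_diff_triangle_le[of "tilted_char \<theta> s" "1 - s\<^sup>2 / 2" _ "exp (- s\<^sup>2 / 2)"] by fastforce
qed

end

text \<open>
  Since $1 + x \le e^x$, the exponent is at most $124 |t| - t^2/4$, which has the maximum $124^2 = 15376$.
\<close>

lemma gaussian_beats_polynomial:
  fixes t :: real
  shows "(1 + \<bar>t\<bar>) ^ 4 * exp (- t\<^sup>2 / 4 + 120 * \<bar>t\<bar>) \<le> exp 15376"
proof -
  have "(1 + \<bar>t\<bar>) ^ 4 \<le> exp \<bar>t\<bar> ^ 4"
    by (intro power_mono) auto
  also have "\<dots> = exp (4 * \<bar>t\<bar>)"
    by (simp flip: exp_of_nat_mult)
  finally have "(1 + \<bar>t\<bar>) ^ 4 * exp (- t\<^sup>2 / 4 + 120 * \<bar>t\<bar>) \<le> exp (4 * \<bar>t\<bar>) * exp (- t\<^sup>2 / 4 + 120 * \<bar>t\<bar>)"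
    by (intro mult_right_mono) auto
  also have "\<dots> = exp (124 * \<bar>t\<bar> - t\<^sup>2 / 4)"
    by (simp flip: exp_add)
  also have "124 * \<bar>t\<bar> - t\<^sup>2 / 4 \<le> 15376"
    using zero_le_power2[of "\<bar>t\<bar> / 2 - 124"] by (simp add: power2_eq_square algebra_simps)
  finally show ?thesis by simp
qed

context standard_subgaussian
begin

text \<open>
  With $\theta = u/\sqrt n$ and $s = t/\sqrt n$, the bound \<open>K\<close> on both characteristic functions has the $n$-th power
  $\exp(-t^2/4 + 120 (u^2/\sqrt n) |t|)$; the hypothesis $u^2 \le \sqrt n$ keeps the linear term bounded. The difference
  of the $n$-th powers is at most $n K^{n-1}$ times the difference, and each of its three terms carries a factor
  $n^{-3/2}$.
\<close>

lemma tilted_char_power: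
  assumes n: "1 \<le> n" and u: "0 \<le> u" "u\<^sup>2 \<le> sqrt n" "u \<le> sqrt n / 600" and t: "\<bar>t\<bar> \<le> sqrt n / 600"
  defines "\<psi> \<equiv> tilted_char (u / sqrt n) (t / sqrt n)"
  shows "cmod (\<psi> ^ n) \<le> exp 15376 / (1 + \<bar>t\<bar>)\<^sup>2"
    and "cmod (\<psi> ^ n - complex_of_real (exp (- t\<^sup>2 / 2))) \<le> (240 * exp 15376 * (1 + u\<^sup>2) / sqrt n) * \<bar>t\<bar> / (1 + \<bar>t\<bar>)\<^sup>2"
proof -
  define \<theta> where "\<theta> = u / sqrt n"
  define s where "s = t / sqrt n"
  define K where "K = exp (- s\<^sup>2 / 4 + 120 * \<theta>\<^sup>2 * \<bar>s\<bar>)"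
  have n0: "0 < sqrt n" "sqrt n * sqrt n = n" "0 < real n"
    using n by auto
  have \<theta>: "0 \<le> \<theta>" "\<theta> \<le> 1 / 600" and s: "\<bar>s\<bar> \<le> 1 / 600"
    using u t n0 by (auto simp: \<theta>_def s_def field_simps)
  note b = tilted_char_bounds[OF \<theta> s, folded K_def]
  have \<psi>: "\<psi> = tilted_char \<theta> s" by (simp add: \<psi>_def \<theta>_def s_def)
  have K0: "0 < K" by (simp add: K_def)
  have Kn: "K ^ n \<le> exp (- t\<^sup>2 / 4 + 120 * \<bar>t\<bar>)"
  proof -
    have "real n * (- s\<^sup>2 / 4 + 120 * \<theta>\<^sup>2 * \<bar>s\<bar>) = - t\<^sup>2 / 4 + 120 * (u\<^sup>2 / sqrt n) * \<bar>t\<bar>"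
      using n0 by (simp add: s_def \<theta>_def power_divide abs_divide field_simps)
    also have "\<dots> \<le> - t\<^sup>2 / 4 + 120 * 1 * \<bar>t\<bar>"
      using u n0 by (intro add_left_mono mult_right_mono mult_left_mono) auto
    finally show ?thesis
      by (simp add: K_def flip: exp_of_nat_mult)
  qed
  have t1: "0 < 1 + \<bar>t\<bar>" by simp
  have poly: "exp (- t\<^sup>2 / 4 + 120 * \<bar>t\<bar>) \<le> exp 15376 / (1 + \<bar>t\<bar>) ^ 4"
    using gaussian_beats_polynomial[of t] t1 by (simp add: field_simps)
  have "cmod (\<psi> ^ n) \<le> K ^ n"
    unfolding norm_power \<psi> by (intro power_mono b) auto
  also have "\<dots> \<le> exp 15376 / (1 + \<bar>t\<bar>) ^ 4"
    using Kn poly by linarith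
  also have "\<dots> \<le> exp 15376 / (1 + \<bar>t\<bar>)\<^sup>2"
    by (intro divide_left_mono power_increasing) auto
  finally show "cmod (\<psi> ^ n) \<le> exp 15376 / (1 + \<bar>t\<bar>)\<^sup>2" .

  have g: "complex_of_real (exp (- t\<^sup>2 / 2)) = complex_of_real (exp (- s\<^sup>2 / 2)) ^ n"
    using n0 by (simp add: s_def power_divide flip: of_real_power exp_of_nat_mult)
  have gK: "cmod (complex_of_real (exp (- s\<^sup>2 / 2))) \<le> K"
  proof -
    have "- s\<^sup>2 / 2 \<le> - s\<^sup>2 / 4" "0 \<le> 120 * \<theta>\<^sup>2 * \<bar>s\<bar>" by auto
    then have "- s\<^sup>2 / 2 \<le> - s\<^sup>2 / 4 + 120 * \<theta>\<^sup>2 * \<bar>s\<bar>" by linarith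
    then show ?thesis
      unfolding norm_of_real K_def abs_exp_cancel exp_le_cancel_iff .
  qed
  have scale: "real n * ((120 * \<theta>\<^sup>2 * \<bar>s\<bar> + 75 * \<theta> * s\<^sup>2 + 41 * \<bar>s\<bar> ^ 3) * 2)
      = 2 / sqrt n * (120 * u\<^sup>2 * \<bar>t\<bar> + 75 * u * \<bar>t\<bar> * \<bar>t\<bar> + 41 * \<bar>t\<bar> ^ 3)"
  proof -
    have "r * r * ((120 * (u / r)\<^sup>2 * (a / r) + 75 * (u / r) * (a / r)\<^sup>2 + 41 * (a / r) ^ 3) * 2)
      = 2 / r * (120 * u\<^sup>2 * a + 75 * u * a * a + 41 * a ^ 3)" if "0 < r" for a r :: real
      using that by (simp add: field_simps power2_eq_square power3_eq_cube)
    from this[of "sqrt n" "\<bar>t\<bar>"] show ?thesis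
      using n0 by (simp add: s_def \<theta>_def abs_divide power_divide)
  qed
  have bound: "120 * u\<^sup>2 * \<bar>t\<bar> + 75 * u * \<bar>t\<bar> * \<bar>t\<bar> + 41 * \<bar>t\<bar> ^ 3 \<le> 120 * ((1 + u\<^sup>2) * \<bar>t\<bar> * (1 + \<bar>t\<bar>)\<^sup>2)"
  proof -
    have "u \<le> 1 + u\<^sup>2"
      using zero_le_power2[of "u - 1"] u(1) by (simp add: power2_eq_square algebra_simps)
    then have "u * (\<bar>t\<bar> * \<bar>t\<bar>) \<le> (1 + u\<^sup>2) * (\<bar>t\<bar> * \<bar>t\<bar>)"
      by (intro mult_right_mono) auto
    moreover have "0 \<le> u\<^sup>2 * \<bar>t\<bar> ^ 3" "0 \<le> u\<^sup>2 * (\<bar>t\<bar> * \<bar>t\<bar>)" "0 \<le> \<bar>t\<bar> ^ 3" "0 \<le> \<bar>t\<bar> * \<bar>t\<bar>" "0 \<le> \<bar>t\<bar>" "0 \<le> u\<^sup>2 * \<bar>t\<bar>" by auto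
    ultimately show ?thesis
      by (simp only: power2_sum power3_eq_cube[of "\<bar>t\<bar>"] power2_eq_square[of "\<bar>t\<bar>"] ring_distribs mult.assoc mult_1_left mult_1_right power_one)
  qed
  \<comment> \<open>Both numbers are divided by their common bound \<open>K\<close>, since the estimate for powers concerns the unit disc.\<close>
  have "cmod ((\<psi> / K) ^ n - (complex_of_real (exp (- s\<^sup>2 / 2)) / K) ^ n)
      \<le> n * cmod (\<psi> / K - complex_of_real (exp (- s\<^sup>2 / 2)) / K)"
    using K0 b(1) gK by (intro norm_power_diff) (auto simp: norm_divide \<psi>)
  then have "cmod (\<psi> ^ n - complex_of_real (exp (- s\<^sup>2 / 2)) ^ n) / K ^ n
      \<le> n * (cmod (\<psi> - complex_of_real (exp (- s\<^sup>2 / 2))) / K)"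
    using K0 by (simp add: power_divide norm_divide norm_power flip: diff_divide_distrib)
  then have "cmod (\<psi> ^ n - complex_of_real (exp (- t\<^sup>2 / 2))) \<le> K ^ n * (n * (cmod (\<psi> - complex_of_real (exp (- s\<^sup>2 / 2))) / K))"
    using K0 unfolding g by (simp add: divide_le_eq mult.commute)
  also have "\<dots> \<le> exp 15376 / (1 + \<bar>t\<bar>) ^ 4 * (n * ((120 * \<theta>\<^sup>2 * \<bar>s\<bar> + 75 * \<theta> * s\<^sup>2 + 41 * \<bar>s\<bar> ^ 3) * 2))"
  proof (intro mult_mono)
    show "K ^ n \<le> exp 15376 / (1 + \<bar>t\<bar>) ^ 4"
      using Kn poly by linarith
    have "s\<^sup>2 \<le> (1 / 600)\<^sup>2"
      using power_mono[OF s, of 2] by simp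
    then have "1 / 2 \<le> 1 + (- s\<^sup>2 / 4)" by (simp add: power2_eq_square)
    also have "\<dots> \<le> 1 + (- s\<^sup>2 / 4 + 120 * \<theta>\<^sup>2 * \<bar>s\<bar>)" by simp
    also have "\<dots> \<le> K"
      unfolding K_def by (rule exp_ge_add_one_self)
    finally have "1 / K \<le> 2"
      using K0 by (simp add: field_simps)
    then show "cmod (\<psi> - complex_of_real (exp (- s\<^sup>2 / 2))) / K
      \<le> (120 * \<theta>\<^sup>2 * \<bar>s\<bar> + 75 * \<theta> * s\<^sup>2 + 41 * \<bar>s\<bar> ^ 3) * 2"
      using mult_mono[OF b(2), of "1 / K" 2] K0 \<theta> by (simp add: \<psi>)
  qed (use K0 in auto)
  also have "\<dots> \<le> exp 15376 / (1 + \<bar>t\<bar>) ^ 4 * (2 / sqrt n * (120 * ((1 + u\<^sup>2) * \<bar>t\<bar> * (1 + \<bar>t\<bar>)\<^sup>2)))"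
    unfolding scale using n0 by (intro mult_left_mono bound) auto
  also have "\<dots> = (240 * exp 15376 * (1 + u\<^sup>2) / sqrt n) * \<bar>t\<bar> / (1 + \<bar>t\<bar>)\<^sup>2"
  proof -
    have "E / p ^ 4 * (2 / r * (120 * (v * a * p\<^sup>2))) = (240 * E * v / r) * a / p\<^sup>2"
      if "0 < p" "0 < r" for E p r v a :: real
      using that by (simp add: field_simps power2_eq_square power4_eq_xxxx)
    from this[OF t1 n0(1), of "exp 15376" "1 + u\<^sup>2" "\<bar>t\<bar>"] show ?thesis .
  qed
  finally show "cmod (\<psi> ^ n - complex_of_real (exp (- t\<^sup>2 / 2))) \<le> (240 * exp 15376 * (1 + u\<^sup>2) / sqrt n) * \<bar>t\<bar> / (1 + \<bar>t\<bar>)\<^sup>2" .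
qed

end

section \<open>Integrals over half-lines and tail functions\<close>

text \<open>
  Layer-cake formula: write $g(x) = g(t) + \int_t^x g'(u)\,du$ for $x > t$ and exchange the two integrations.
\<close>

lemma (in real_distribution) tail_formula:
  fixes g g' :: "real \<Rightarrow> real"
  assumes [measurable]: "g \<in> borel_measurable borel" "g' \<in> borel_measurable borel"
    and deriv: "\<And>x. t \<le> x \<Longrightarrow> (g has_real_derivative g' x) (at x)"
    and g': "\<And>x. t \<le> x \<Longrightarrow> 0 \<le> g' x"
    and int: "integrable M (\<lambda>x. indicator {t<..} x * g x)"
  shows "integrable lborel (\<lambda>u. indicator {t..} u * (g' u * measure M {u<..}))"
    and "(\<integral>x. indicator {t<..} x * g x \<partial>M)
      = g t * measure M {t<..} + (\<integral>u. indicator {t..} u * (g' u * measure M {u<..}) \<partial>lborel)"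
proof -
  interpret P: pair_sigma_finite M lborel ..
  define f where "f x u = ennreal (g' u) * indicator {t..} u * indicator {u<..} x" for x u
  have [measurable]: "(\<lambda>(x, u). f x u) \<in> borel_measurable (M \<Otimes>\<^sub>M lborel)"
  proof -
    have "(\<lambda>(x, u). ennreal (g' u) * indicator {t..} u * indicator {p. snd p < fst p} (x, u)) \<in> borel_measurable (M \<Otimes>\<^sub>M lborel)"
      by measurable
    then show ?thesis
      by (rule measurable_cong[THEN iffD1, rotated]) (auto simp: f_def indicator_def)
  qed
  have mono: "g t \<le> g x" if "t \<le> x" for x
    using that by (rule DERIV_nonneg_imp_nondecreasing) (use deriv g' in \<open>meson order_trans\<close>)
  have inner: "(\<integral>\<^sup>+u. f x u \<partial>lborel) = ennreal (indicator {t<..} x * (g x - g t))" for x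
  proof (cases "t < x")
    case True
    have "(\<integral>\<^sup>+u. f x u \<partial>lborel) = (\<integral>\<^sup>+u. ennreal (g' u) * indicator {t..x} u \<partial>lborel)"
      by (intro nn_integral_cong_AE) (use AE_lborel_singleton[of x] in \<open>auto simp: f_def indicator_def\<close>)
    also have "\<dots> = g x - g t"
      using True by (intro nn_integral_FTC_Icc)
        (auto intro!: g' deriv has_vector_derivative_at_within simp flip: has_real_derivative_iff_has_vector_derivative)
    finally show ?thesis using True by simp
  next
    case False
    then have "f x u = 0" for u by (auto simp: f_def indicator_def)
    then show ?thesis using False by simp
  qed
  have outer: "(\<integral>\<^sup>+x. f x u \<partial>M) = ennreal (indicator {t..} u * (g' u * measure M {u<..}))" for u
  proof -
    have "(\<integral>\<^sup>+x. f x u \<partial>M) = ennreal (g' u) * indicator {t..} u * emeasure M {u<..}"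
      unfolding f_def by (subst nn_integral_cmult) auto
    then show ?thesis
      using g'[of u] by (auto simp: emeasure_eq_measure ennreal_mult indicator_def)
  qed
  have swap: "(\<integral>\<^sup>+x. ennreal (indicator {t<..} x * (g x - g t)) \<partial>M)
      = (\<integral>\<^sup>+u. ennreal (indicator {t..} u * (g' u * measure M {u<..})) \<partial>lborel)"
    unfolding inner[symmetric] outer[symmetric] by (rule P.Fubini'[symmetric]) measurable
  have ind: "integrable M (indicator {t<..} :: real \<Rightarrow> real)"
    by (intro integrable_real_indicator) (auto simp: emeasure_eq_measure)
  \<comment> \<open>The increment of \<open>g\<close> is used instead of \<open>g\<close> because it is nonnegative, as the Lebesgue integral requires.\<close>
  have eq: "(\<lambda>x. indicator {t<..} x * (g x - g t)) = (\<lambda>x. indicator {t<..} x * g x - g t * indicator {t<..} x)"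
    by (auto simp: algebra_simps)
  have int': "integrable M (\<lambda>x. indicator {t<..} x * (g x - g t))"
    unfolding eq by (intro Bochner_Integration.integrable_diff int integrable_mult_right ind)
  have meas: "(\<lambda>u. indicator {t..} u * (g' u * measure M {u<..})) \<in> borel_measurable lborel"
  proof -
    have "(\<lambda>u. measure M {u<..}) = (\<lambda>u. 1 - cdf M u)"
    proof
      fix u
      have "measure M {u<..} = measure M (space M - {..u})"
        by (intro arg_cong[where f = "measure M"]) auto
      also have "\<dots> = 1 - cdf M u"
        unfolding cdf_def by (rule prob_compl) auto
      finally show "measure M {u<..} = 1 - cdf M u" .
    qed
    moreover have "cdf M \<in> borel_measurable borel"
      by (intro borel_measurable_mono monoI cdf_nondecreasing)
    ultimately have [measurable]: "(\<lambda>u. measure M {u<..}) \<in> borel_measurable borel" by simp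
    show ?thesis by measurable
  qed
  have nonneg: "0 \<le> indicator {t..} u * (g' u * measure M {u<..})" for u
    using g'[of u] by (auto simp: indicator_def)
  have hb: "has_bochner_integral lborel (\<lambda>u. indicator {t..} u * (g' u * measure M {u<..}))
     (\<integral>x. indicator {t<..} x * (g x - g t) \<partial>M)"
  proof (rule has_bochner_integral_nn_integral)
    show "(\<integral>\<^sup>+u. ennreal (indicator {t..} u * (g' u * measure M {u<..})) \<partial>lborel)
        = ennreal (\<integral>x. indicator {t<..} x * (g x - g t) \<partial>M)"
      unfolding swap[symmetric] using int'
      by (rule nn_integral_eq_integral) (use mono in \<open>auto simp: indicator_def\<close>)
    show "0 \<le> (\<integral>x. indicator {t<..} x * (g x - g t) \<partial>M)"
      by (intro integral_nonneg_AE) (use mono in \<open>auto simp: indicator_def\<close>)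
  qed (use meas nonneg in auto)
  show "integrable lborel (\<lambda>u. indicator {t..} u * (g' u * measure M {u<..}))"
    using hb by (simp add: has_bochner_integral_iff)
  have "(\<integral>x. indicator {t<..} x * (g x - g t) \<partial>M) = (\<integral>x. indicator {t<..} x * g x \<partial>M) - g t * measure M {t<..}"
    unfolding eq using int ind by simp
  then show "(\<integral>x. indicator {t<..} x * g x \<partial>M)
      = g t * measure M {t<..} + (\<integral>u. indicator {t..} u * (g' u * measure M {u<..}) \<partial>lborel)"
    using hb by (simp add: has_bochner_integral_iff)
qed

lemma tail_comparison:
  fixes g g' e :: "real \<Rightarrow> real" and \<mu> \<nu> :: "real measure"
  assumes "real_distribution \<mu>" "real_distribution \<nu>"
    and meas: "g \<in> borel_measurable borel" "g' \<in> borel_measurable borel"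
    and deriv: "\<And>x. t \<le> x \<Longrightarrow> (g has_real_derivative g' x) (at x)"
    and g': "\<And>x. t \<le> x \<Longrightarrow> 0 \<le> g' x"
    and g: "0 \<le> g t"
    and int: "integrable \<mu> (\<lambda>x. indicator {t<..} x * g x)" "integrable \<nu> (\<lambda>x. indicator {t<..} x * g x)"
    and e: "\<And>u. t \<le> u \<Longrightarrow> \<bar>measure \<mu> {u<..} - measure \<nu> {u<..}\<bar> \<le> e u"
    and inte: "integrable lborel (\<lambda>u. indicator {t..} u * (g' u * e u))"
  shows "\<bar>(\<integral>x. indicator {t<..} x * g x \<partial>\<mu>) - (\<integral>x. indicator {t<..} x * g x \<partial>\<nu>)\<bar>
    \<le> g t * e t + (\<integral>u. indicator {t..} u * (g' u * e u) \<partial>lborel)"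
proof -
  have F: "integrable lborel (\<lambda>u. indicator {t..} u * (g' u * measure M {u<..}))"
    "(\<integral>x. indicator {t<..} x * g x \<partial>M)
      = g t * measure M {t<..} + (\<integral>u. indicator {t..} u * (g' u * measure M {u<..}) \<partial>lborel)"
    if "real_distribution M" "integrable M (\<lambda>x. indicator {t<..} x * g x)" for M
  proof -
    interpret real_distribution M by fact
    show "integrable lborel (\<lambda>u. indicator {t..} u * (g' u * measure M {u<..}))"
      by (rule tail_formula(1)[OF meas]) (fact deriv g' that(2))+
    show "(\<integral>x. indicator {t<..} x * g x \<partial>M)
      = g t * measure M {t<..} + (\<integral>u. indicator {t..} u * (g' u * measure M {u<..}) \<partial>lborel)"
      by (rule tail_formula(2)[OF meas]) (fact deriv g' that(2))+
  qed
  note F\<mu> = F[OF assms(1) int(1)] and F\<nu> = F[OF assms(2) int(2)]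
  have eq: "(\<integral>x. indicator {t<..} x * g x \<partial>\<mu>) - (\<integral>x. indicator {t<..} x * g x \<partial>\<nu>)
    = g t * (measure \<mu> {t<..} - measure \<nu> {t<..})
      + (\<integral>u. indicator {t..} u * (g' u * measure \<mu> {u<..}) - indicator {t..} u * (g' u * measure \<nu> {u<..}) \<partial>lborel)"
    unfolding F\<mu>(2) F\<nu>(2) by (subst Bochner_Integration.integral_diff[OF F\<mu>(1) F\<nu>(1)]) (simp add: algebra_simps)
  have le: "\<bar>g t * (measure \<mu> {t<..} - measure \<nu> {t<..})\<bar> \<le> g t * e t"
    using e[of t] g by (simp add: abs_mult mult_left_mono)
  have "\<bar>\<integral>u. indicator {t..} u * (g' u * measure \<mu> {u<..}) - indicator {t..} u * (g' u * measure \<nu> {u<..}) \<partial>lborel\<bar>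
        \<le> (\<integral>u. indicator {t..} u * (g' u * e u) \<partial>lborel)"
    unfolding real_norm_def[symmetric]
  proof (rule norm_integral_le[OF inte])
    fix u
    have "\<bar>g' u * (measure \<mu> {u<..} - measure \<nu> {u<..})\<bar> \<le> g' u * e u" if "t \<le> u"
      using mult_left_mono[OF e[OF that] g'[OF that]] g'[OF that] by (simp add: abs_mult)
    then show "norm (indicator {t..} u * (g' u * measure \<mu> {u<..}) - indicator {t..} u * (g' u * measure \<nu> {u<..}))
          \<le> indicator {t..} u * (g' u * e u)"
      by (simp add: indicator_def right_diff_distrib)
  qed
  then show ?thesis
    using le unfolding eq by (intro order_trans[OF abs_triangle_ineq] add_mono)
qed

text \<open>
  The function $1 - e^{-uy}$ is increasing with total variation at most $1$, so a uniform bound on the distance of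
  the tails is inherited once by the mass of the half-line and once by the integral of that function.
\<close>

lemma tail_comparison_exp:
  fixes \<mu> \<nu> :: "real measure"
  assumes "real_distribution \<mu>" "real_distribution \<nu>" and u: "0 \<le> u"
    and d: "\<And>y. 0 \<le> y \<Longrightarrow> \<bar>measure \<mu> {y<..} - measure \<nu> {y<..}\<bar> \<le> \<delta>"
  shows "\<bar>(\<integral>y. indicator {0<..} y * exp (- (u * y)) \<partial>\<mu>) - (\<integral>y. indicator {0<..} y * exp (- (u * y)) \<partial>\<nu>)\<bar> \<le> 2 * \<delta>"
proof -
  have \<delta>: "0 \<le> \<delta>" using d[of 0] by linarith
  have int: "integrable M (\<lambda>y. indicator {0<..} y * exp (- (u * y)))" if "real_distribution M" for M
  proof -
    interpret real_distribution M by fact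
    show ?thesis
      by (rule integrable_const_bound[where B = 1]) (use u in \<open>auto simp: indicator_def\<close>)
  qed
  have int': "integrable M (\<lambda>y. indicator {0<..} y * (1 - exp (- (u * y))))" if "real_distribution M" for M
  proof -
    interpret real_distribution M by fact
    show ?thesis
      by (rule integrable_const_bound[where B = 1]) (use u in \<open>auto simp: indicator_def\<close>)
  qed
  have split: "(\<integral>y. indicator {0<..} y * exp (- (u * y)) \<partial>M)
      = measure M {0<..} - (\<integral>y. indicator {0<..} y * (1 - exp (- (u * y))) \<partial>M)" if "real_distribution M" for M
  proof -
    interpret real_distribution M by fact
    have "(\<integral>y. indicator {0<..} y * exp (- (u * y)) \<partial>M) + (\<integral>y. indicator {0<..} y * (1 - exp (- (u * y))) \<partial>M)
       = (\<integral>y. indicator {0<..} y \<partial>M)"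
      by (subst Bochner_Integration.integral_add[symmetric, OF int[OF that] int'[OF that]]) (simp add: algebra_simps)
    then show ?thesis by simp
  qed
  have FTC: "has_bochner_integral lborel (\<lambda>y. indicator {0..} y * (u * exp (- (u * y)) * \<delta>)) (if u = 0 then 0 else \<delta>)"
  proof (cases "u = 0")
    case False
    then have "0 < u" using u by simp
    have "((\<lambda>y. - exp (- (u * y)) * \<delta>) \<longlongrightarrow> - 0 * \<delta>) at_top"
      using \<open>0 < u\<close> by (intro tendsto_intros) real_asymp
    then have "(\<integral>\<^sup>+y. ennreal (u * exp (- (u * y)) * \<delta>) * indicator {0..} y \<partial>lborel) = ennreal (- 0 * \<delta> - (- exp (- (u * 0)) * \<delta>))"
      using \<open>0 < u\<close> \<delta>
      by (intro nn_integral_FTC_atLeast[where F = "\<lambda>y. - exp (- (u * y)) * \<delta>"]) (auto intro!: derivative_eq_intros)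
    then have "(\<integral>\<^sup>+y. ennreal (indicator {0..} y * (u * exp (- (u * y)) * \<delta>)) \<partial>lborel) = ennreal \<delta>"
      by (simp add: ennreal_mult' ennreal_indicator[symmetric] mult.commute[of "ennreal (indicator _ _)"] del: ennreal_indicator)
    then show ?thesis
      using False \<delta> u by (intro has_bochner_integral_nn_integral) (auto simp: indicator_def)
  qed (simp add: has_bochner_integral_zero)
  have "\<bar>(\<integral>y. indicator {0<..} y * (1 - exp (- (u * y))) \<partial>\<mu>) - (\<integral>y. indicator {0<..} y * (1 - exp (- (u * y))) \<partial>\<nu>)\<bar>
    \<le> (1 - exp (- (u * 0))) * \<delta> + (\<integral>y. indicator {0..} y * (u * exp (- (u * y)) * \<delta>) \<partial>lborel)"
  proof (rule tail_comparison[OF assms(1,2)])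
    show "integrable lborel (\<lambda>y. indicator {0..} y * (u * exp (- (u * y)) * \<delta>))"
      using FTC by (simp add: has_bochner_integral_iff)
  qed (use u d int' assms(1,2) in \<open>auto intro!: derivative_eq_intros\<close>)
  also have "\<dots> \<le> \<delta>"
    using FTC \<delta> by (auto simp: has_bochner_integral_iff)
  finally show ?thesis
    using d[of 0] unfolding split[OF assms(1)] split[OF assms(2)] by linarith
qed

definition normal_tail :: "real \<Rightarrow> real" where
  "normal_tail u = measure std_normal_distribution {u<..}"

lemma normal_tail_eq_cdf: "1 - std_normal_cdf u = normal_tail u"
proof -
  interpret real_distribution std_normal_distribution by (rule real_dist_normal_dist)
  have "measure std_normal_distribution {u<..} = measure std_normal_distribution (space std_normal_distribution - {..u})"
    by (intro arg_cong[where f = "measure std_normal_distribution"]) auto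
  also have "\<dots> = 1 - std_normal_cdf u"
    unfolding cdf_def std_normal_cdf_def by (rule prob_compl) auto
  finally show ?thesis by (simp add: normal_tail_def)
qed

lemma integral_std_normal:
  fixes f :: "real \<Rightarrow> real"
  assumes "f \<in> borel_measurable borel"
  shows "(\<integral>x. f x \<partial>std_normal_distribution) = (\<integral>x. std_normal_density x * f x \<partial>lborel)"
    and "integrable std_normal_distribution f \<longleftrightarrow> integrable lborel (\<lambda>x. std_normal_density x * f x)"
  using assms by (simp_all add: integral_density integrable_density)

text \<open>
  The tilting identity for the normal law: substitute $x = u + y$ and expand the square.
\<close>

lemma normal_tail_tilt:
  "normal_tail u = exp (- u\<^sup>2 / 2) * (\<integral>y. indicator {0<..} y * exp (- (u * y)) \<partial>std_normal_distribution)"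
proof -
  have "normal_tail u = (\<integral>x. indicator {u<..} x \<partial>std_normal_distribution)"
    by (simp add: normal_tail_def)
  also have "\<dots> = (\<integral>x. std_normal_density x * indicator {u<..} x \<partial>lborel)"
    by (intro integral_std_normal) auto
  also have "\<dots> = (\<integral>y. std_normal_density (u + 1 * y) * indicator {u<..} (u + 1 * y) \<partial>lborel)"
    by (subst lborel_integral_real_affine[where c = 1 and t = u]) auto
  also have "\<dots> = (\<integral>y. exp (- u\<^sup>2 / 2) * (std_normal_density y * (indicator {0<..} y * exp (- (u * y)))) \<partial>lborel)"
  proof (intro Bochner_Integration.integral_cong refl)
    fix y :: real
    have "std_normal_density (u + y) = exp (- u\<^sup>2 / 2) * (std_normal_density y * exp (- (u * y)))"
      by (simp add: std_normal_density_def power2_sum add_divide_distrib flip: exp_add)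
    then show "std_normal_density (u + 1 * y) * indicator {u<..} (u + 1 * y)
        = exp (- u\<^sup>2 / 2) * (std_normal_density y * (indicator {0<..} y * exp (- (u * y))))"
      by (simp add: indicator_def)
  qed
  also have "\<dots> = exp (- u\<^sup>2 / 2) * (\<integral>y. indicator {0<..} y * exp (- (u * y)) \<partial>std_normal_distribution)"
    by (subst integral_std_normal) auto
  finally show ?thesis .
qed

lemma std_normal_density_le_1: "std_normal_density x \<le> 1"
proof -
  have "1 \<le> sqrt (2 * pi)" using pi_gt3 by simp
  then have "1 / sqrt (2 * pi) \<le> 1" by (simp add: divide_le_eq)
  then have "1 / sqrt (2 * pi) * exp (- x\<^sup>2 / 2) \<le> 1 * 1"
    by (intro mult_mono) auto
  then show ?thesis by (simp add: std_normal_density_def)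
qed

text \<open>
  Bounds of Mills type. By the tilting identity they are bounds for \<open>J\<close>, the integral of $e^{-uy}$ over $y > 0$ under the
  normal law: it is at most $1$, it is at most $1/u$ because the density is at most $1$, and the part
  $y \le 1/(1+u)$ already contributes a multiple of $1/(1+u)$.
\<close>

lemma normal_tail_bounds:
  assumes u: "0 \<le> u"
  shows "normal_tail u \<le> exp (- u\<^sup>2 / 2)"
    and "u * normal_tail u \<le> exp (- u\<^sup>2 / 2)"
    and "exp (- u\<^sup>2 / 2) \<le> 24 * (1 + u) * normal_tail u"
proof -
  interpret real_distribution std_normal_distribution by (rule real_dist_normal_dist)
  define J where "J = (\<integral>y. indicator {0<..} y * exp (- (u * y)) \<partial>std_normal_distribution)"
  let ?f = "\<lambda>y. indicator {0<..} y * exp (- (u * y))"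
  have Q: "normal_tail u = exp (- u\<^sup>2 / 2) * J"
    by (simp add: J_def normal_tail_tilt)
  have int: "integrable std_normal_distribution ?f"
    by (rule integrable_const_bound[where B = 1]) (use u in \<open>auto simp: indicator_def\<close>)
  have J: "J = (\<integral>y. std_normal_density y * ?f y \<partial>lborel)"
    unfolding J_def by (intro integral_std_normal) auto
  have int': "integrable lborel (\<lambda>y. std_normal_density y * ?f y)"
    using int by (subst integral_std_normal(2)[symmetric]) auto
  have "J \<le> (\<integral>y. 1 \<partial>std_normal_distribution)"
    unfolding J_def by (intro integral_mono int) (use u in \<open>auto simp: indicator_def\<close>)
  then have "J \<le> 1"
    using prob_space by simp
  then show "normal_tail u \<le> exp (- u\<^sup>2 / 2)"
    unfolding Q by simp
  have "u * J \<le> 1"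
  proof (cases "u = 0")
    case False
    then have "0 < u" using u by simp
    have I: "has_bochner_integral lborel (\<lambda>y. u * exp (- (u * y)) * indicator {0..} y) 1"
    proof (rule has_bochner_integral_nn_integral)
      have "((\<lambda>y. - exp (- (u * y))) \<longlongrightarrow> - 0) at_top"
        using \<open>0 < u\<close> by (intro tendsto_intros) real_asymp
      then have "(\<integral>\<^sup>+y. ennreal (u * exp (- (u * y))) * indicator {0..} y \<partial>lborel) = ennreal (- 0 - (- exp (- (u * 0))))"
        using \<open>0 < u\<close> by (intro nn_integral_FTC_atLeast[where F = "\<lambda>y. - exp (- (u * y))"]) (auto intro!: derivative_eq_intros)
      then show "(\<integral>\<^sup>+y. ennreal (u * exp (- (u * y)) * indicator {0..} y) \<partial>lborel) = ennreal 1"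
        by (simp add: ennreal_mult'' ennreal_indicator)
    qed (use u in \<open>auto simp: indicator_def\<close>)
    have "u * J = (\<integral>y. u * (std_normal_density y * ?f y) \<partial>lborel)"
      unfolding J by simp
    also have "\<dots> \<le> (\<integral>y. u * exp (- (u * y)) * indicator {0..} y \<partial>lborel)"
    proof (rule integral_mono)
      show "u * (std_normal_density y * ?f y) \<le> u * exp (- (u * y)) * indicator {0..} y" for y
        using u mult_right_mono[OF std_normal_density_le_1[of y], of "u * exp (- (u * y))"]
        by (auto simp: indicator_def mult_ac)
    qed (use int' I in \<open>auto simp: has_bochner_integral_iff\<close>)
    also have "\<dots> = 1"
      using I by (simp add: has_bochner_integral_iff)
    finally show ?thesis .
  qed simp
  then show "u * normal_tail u \<le> exp (- u\<^sup>2 / 2)"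
    unfolding Q using mult_left_mono[of "u * J" 1 "exp (- u\<^sup>2 / 2)"] by (simp add: mult_ac)
  have dens: "1 / 24 \<le> std_normal_density y * exp (- (u * y))" if y: "0 < y" "y \<le> 1 / (1 + u)" for y
  proof -
    have "(1 + u) * y \<le> 1" using y u by (simp add: field_simps)
    moreover have "0 \<le> u * y" using y u by simp
    ultimately have uy: "u * y \<le> 1" "y \<le> 1" unfolding distrib_right using y by linarith+
    then have "y\<^sup>2 \<le> 1" using y by (simp add: power_le_one)
    have "sqrt (2 * pi) \<le> sqrt 9"
      using pi_less_4 by (intro real_sqrt_le_mono) (use pi_approx in auto)
    then have "sqrt (2 * pi) \<le> 3" by simp
    moreover have "exp (y\<^sup>2 / 2 + u * y) \<le> exp 2"
      using uy(1) \<open>y\<^sup>2 \<le> 1\<close> by simp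
    then have "exp (y\<^sup>2 / 2 + u * y) \<le> 8"
      using exp_2_le by linarith
    ultimately have "sqrt (2 * pi) * exp (y\<^sup>2 / 2 + u * y) \<le> 3 * 8"
      by (intro mult_mono) auto
    then have "1 / 24 \<le> 1 / (sqrt (2 * pi) * exp (y\<^sup>2 / 2 + u * y))"
      using pi_gt_zero by (intro divide_left_mono) auto
    also have "\<dots> = std_normal_density y * exp (- (u * y))"
    proof -
      have "1 / (c * exp (a + b)) = 1 / c * exp (- a) * exp (- b)" for a b c :: real
        by (simp add: exp_add exp_minus field_simps)
      from this[of "sqrt (2 * pi)" "y\<^sup>2 / 2" "u * y"] show ?thesis
        unfolding std_normal_density_def by simp
    qed
    finally show ?thesis .
  qed
  have "1 / 24 * (1 / (1 + u)) = (\<integral>y. 1 / 24 * indicator {0<..1 / (1 + u)} y \<partial>lborel)"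
    using u by simp
  also have "\<dots> \<le> J"
    unfolding J
  proof (rule integral_mono[OF _ int'])
    show "integrable lborel (\<lambda>y. 1 / 24 * indicator {0<..1 / (1 + u)} y :: real)"
      using u by (intro integrable_mult_right integrable_real_indicator) auto
    show "1 / 24 * indicator {0<..1 / (1 + u)} y \<le> std_normal_density y * ?f y" for y
      using dens[of y] by (auto simp: indicator_def)
  qed
  finally have "1 \<le> 24 * (1 + u) * J"
    using u by (simp add: field_simps)
  from mult_left_mono[OF this, of "exp (- u\<^sup>2 / 2)"]
  show "exp (- u\<^sup>2 / 2) \<le> 24 * (1 + u) * normal_tail u"
    unfolding Q by (simp add: mult_ac)
qed

context standard_subgaussian
begin

section \<open>Normal approximation of the sum of independent variables\<close>

definition sum_law :: "nat \<Rightarrow> real measure" where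
  "sum_law n = distr (PiM {1..n} (\<lambda>_. \<rho>)) borel (\<lambda>x. (\<Sum>i=1..n. x i) / sqrt n)"

lemma measurable_normalized_sum [measurable]:
  "(\<lambda>x. (\<Sum>i=1..n. x i) / sqrt (real n)) \<in> borel_measurable (PiM {1..n} (\<lambda>_. \<rho>))"
proof -
  have "(\<lambda>x. x i) \<in> borel_measurable (PiM {1..n} (\<lambda>_. \<rho>))" if "i \<in> {1..n}" for i
    using measurable_component_singleton[OF that, of "\<lambda>_. \<rho>"]
      measurable_cong_sets[OF refl events_eq_borel, of "PiM {1..n} (\<lambda>_. \<rho>)"] by blast
  then show ?thesis
    by (intro borel_measurable_divide borel_measurable_sum borel_measurable_const)
qed

lemma real_distribution_sum_law: "real_distribution (sum_law n)"
proof -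
  interpret P: product_prob_space "\<lambda>_. \<rho>" "{1..n}" ..
  show ?thesis
    unfolding sum_law_def by (rule P.real_distribution_distr) measurable
qed

lemma integral_PiM_prod:
  fixes h :: "real \<Rightarrow> 'b :: {real_normed_field, banach, second_countable_topology}"
  assumes "integrable \<rho> h"
  shows "integrable (PiM {1..n} (\<lambda>_. \<rho>)) (\<lambda>x. \<Prod>i=1..n. h (x i))"
    and "(\<integral>x. (\<Prod>i=1..n. h (x i)) \<partial>PiM {1..n} (\<lambda>_. \<rho>)) = (\<integral>x. h x \<partial>\<rho>) ^ n"
proof -
  interpret P: product_prob_space "\<lambda>_. \<rho>" "{1..n}" ..
  show "integrable (PiM {1..n} (\<lambda>_. \<rho>)) (\<lambda>x. \<Prod>i=1..n. h (x i))"
    using assms by (intro P.product_integrable_prod) auto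
  show "(\<integral>x. (\<Prod>i=1..n. h (x i)) \<partial>PiM {1..n} (\<lambda>_. \<rho>)) = (\<integral>x. h x \<partial>\<rho>) ^ n"
    using assms by (subst P.product_integral_prod) auto
qed

lemma exp_scaled_sum: "exp (u * ((\<Sum>i=1..n. x i) / r)) = (\<Prod>i=1..n. exp (u / r * x i))"
  for x :: "nat \<Rightarrow> real"
proof -
  have "u * ((\<Sum>i=1..n. x i) / r) = (\<Sum>i=1..n. u / r * x i)"
    unfolding sum_distrib_left[symmetric] by simp
  then show ?thesis by (simp only: exp_sum finite_atLeastAtMost)
qed

lemma sum_law_mgf:
  shows integrable_sum_law_exp: "integrable (sum_law n) (\<lambda>x. exp (u * x))"
    and integral_sum_law_exp: "(\<integral>x. exp (u * x) \<partial>sum_law n) = mgf (u / sqrt n) ^ n"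
proof -
  note * = exp_scaled_sum[of u _ n "sqrt n"]
  note P = integral_PiM_prod[OF integrable_exp[of "u / sqrt n"], of n]
  show "integrable (sum_law n) (\<lambda>x. exp (u * x))"
    using P(1)[folded *] unfolding sum_law_def by (subst integrable_distr_eq) auto
  show "(\<integral>x. exp (u * x) \<partial>sum_law n) = mgf (u / sqrt n) ^ n"
    using P(2)[folded *] unfolding sum_law_def mgf_def by (subst integral_distr) auto
qed

text \<open>
  The shift by $u$ is distributed evenly: $T - u = n^{-1/2} \sum_i (X_i - u/\sqrt n)$, so that the integrand is a
  product over the coordinates.
\<close>

lemma sum_law_tilted_char:
  assumes "1 \<le> n"
  shows "(CLINT x|sum_law n. exp (u * x) *\<^sub>R iexp (t * (x - u)))
    = (mgf (u / sqrt n) * tilted_char (u / sqrt n) (t / sqrt n)) ^ n"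
proof -
  define h where "h x = exp (u / sqrt n * x) *\<^sub>R iexp (t / sqrt n * (x - u / sqrt n))" for x
  have n: "0 < sqrt n" using assms by simp
  have int: "integrable \<rho> h"
  proof (rule Bochner_Integration.integrable_bound[OF integrable_exp[of "u / sqrt n"]])
    show "AE x in \<rho>. norm (h x) \<le> norm (exp (u / sqrt n * x))"
      by (simp add: h_def)
  qed (simp add: h_def[abs_def])
  have "exp (u * ((\<Sum>i=1..n. x i) / sqrt n)) *\<^sub>R iexp (t * ((\<Sum>i=1..n. x i) / sqrt n - u)) = (\<Prod>i=1..n. h (x i))"
    for x :: "nat \<Rightarrow> real"
  proof -
    have "(\<Sum>i=1..n. x i - u / sqrt n) = (\<Sum>i=1..n. x i) - n * (u / sqrt n)"
      by (simp add: sum_subtractf)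
    also have "\<dots> = (\<Sum>i=1..n. x i) - sqrt n * u"
    proof -
      have "real n * (u / sqrt n) = real n / sqrt n * u" by simp
      then show ?thesis by (simp only: real_div_sqrt of_nat_0_le_iff)
    qed
    finally have s: "(\<Sum>i=1..n. x i - u / sqrt n) = (\<Sum>i=1..n. x i) - sqrt n * u" .
    have "t / sqrt n * (\<Sum>i=1..n. x i - u / sqrt n) = t * ((\<Sum>i=1..n. x i) / sqrt n - u)"
      unfolding s using n by (simp add: field_simps)
    then have "iexp (t * ((\<Sum>i=1..n. x i) / sqrt n - u)) = iexp (\<Sum>i=1..n. t / sqrt n * (x i - u / sqrt n))"
      by (simp only: sum_distrib_left)
    also have "\<dots> = (\<Prod>i=1..n. iexp (t / sqrt n * (x i - u / sqrt n)))"
      unfolding of_real_sum sum_distrib_left by (rule exp_sum) simp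
    finally have 1: "iexp (t * ((\<Sum>i=1..n. x i) / sqrt n - u)) = (\<Prod>i=1..n. iexp (t / sqrt n * (x i - u / sqrt n)))" .
    show ?thesis
      unfolding 1 h_def scaleR_conv_of_real exp_scaled_sum by (simp only: prod.distrib of_real_prod)
  qed
  then have "(CLINT x|sum_law n. exp (u * x) *\<^sub>R iexp (t * (x - u))) = (\<integral>x. (\<Prod>i=1..n. h (x i)) \<partial>PiM {1..n} (\<lambda>_. \<rho>))"
    unfolding sum_law_def by (subst integral_distr) auto
  also have "\<dots> = (\<integral>x. h x \<partial>\<rho>) ^ n"
    by (rule integral_PiM_prod(2)[OF int])
  also have "(\<integral>x. h x \<partial>\<rho>) = mgf (u / sqrt n) * tilted_char (u / sqrt n) (t / sqrt n)"
    using mgf_bounds(1)[of "u / sqrt n"] by (simp add: tilted_char_def h_def)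
  finally show ?thesis .
qed

text \<open>
  The law of $T - u$ under the probability measure with density $e^{uT}/M(u/\sqrt n)^n$.
\<close>

definition tilted_law :: "nat \<Rightarrow> real \<Rightarrow> real measure" where
  "tilted_law n u = distr (density (sum_law n) (\<lambda>x. ennreal (exp (u * x) / mgf (u / sqrt n) ^ n))) borel (\<lambda>x. x - u)"

lemma mgf_power_pos: "0 < mgf t ^ n"
  using mgf_bounds(1)[of t] by (intro zero_less_power) linarith

lemma sets_sum_law [measurable_cong, simp]: "sets (sum_law n) = sets borel"
  by (simp add: sum_law_def)

lemma real_distribution_tilted_law: "real_distribution (tilted_law n u)"
proof -
  let ?D = "density (sum_law n) (\<lambda>x. ennreal (exp (u * x) / mgf (u / sqrt n) ^ n))"
  interpret F: real_distribution "sum_law n" by (rule real_distribution_sum_law)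
  have "emeasure ?D (space ?D) = (\<integral>\<^sup>+x. ennreal (exp (u * x) / mgf (u / sqrt n) ^ n) \<partial>sum_law n)"
    by (subst emeasure_density) (auto intro!: nn_integral_cong)
  also have "\<dots> = ennreal (\<integral>x. exp (u * x) / mgf (u / sqrt n) ^ n \<partial>sum_law n)"
    using integrable_sum_law_exp[of n u] mgf_power_pos[of "u / sqrt n" n]
    by (intro nn_integral_eq_integral) (auto simp: less_imp_le)
  also have "\<dots> = 1"
    using mgf_bounds(1)[of "u / sqrt n"] by (auto simp: integral_sum_law_exp)
  finally interpret D: prob_space ?D
    by (rule prob_spaceI)
  show ?thesis
    unfolding tilted_law_def by (rule D.real_distribution_distr) simp
qed

lemma integral_tilted_law:
  fixes f :: "real \<Rightarrow> 'b :: {banach, second_countable_topology}"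
  assumes f: "f \<in> borel_measurable borel"
  shows "(\<integral>y. f y \<partial>tilted_law n u) = (\<integral>x. (exp (u * x) / mgf (u / sqrt n) ^ n) *\<^sub>R f (x - u) \<partial>sum_law n)"
    and "integrable (tilted_law n u) f \<longleftrightarrow> integrable (sum_law n) (\<lambda>x. (exp (u * x) / mgf (u / sqrt n) ^ n) *\<^sub>R f (x - u))"
proof -
  note [measurable] = f
  have pos: "AE x in sum_law n. 0 \<le> exp (u * x) / mgf (u / sqrt n) ^ n"
    using mgf_power_pos[of "u / sqrt n" n] by (auto simp: less_imp_le)
  show "(\<integral>y. f y \<partial>tilted_law n u) = (\<integral>x. (exp (u * x) / mgf (u / sqrt n) ^ n) *\<^sub>R f (x - u) \<partial>sum_law n)"
    unfolding tilted_law_def by (simp add: integral_distr integral_density pos)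
  show "integrable (tilted_law n u) f \<longleftrightarrow> integrable (sum_law n) (\<lambda>x. (exp (u * x) / mgf (u / sqrt n) ^ n) *\<^sub>R f (x - u))"
    unfolding tilted_law_def by (simp add: integrable_distr_eq integrable_density pos)
qed

lemma char_tilted_law:
  assumes "1 \<le> n"
  shows "char (tilted_law n u) t = tilted_char (u / sqrt n) (t / sqrt n) ^ n"
proof -
  have "char (tilted_law n u) t = (CLINT x|sum_law n. (exp (u * x) / mgf (u / sqrt n) ^ n) *\<^sub>R iexp (t * (x - u)))"
    unfolding char_def by (subst integral_tilted_law) auto
  also have "\<dots> = (CLINT x|sum_law n. (1 / mgf (u / sqrt n) ^ n) *\<^sub>R (exp (u * x) *\<^sub>R iexp (t * (x - u))))"
    by simp
  also have "\<dots> = (1 / mgf (u / sqrt n) ^ n) *\<^sub>R (mgf (u / sqrt n) * tilted_char (u / sqrt n) (t / sqrt n)) ^ n"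
    unfolding integral_scaleR_right sum_law_tilted_char[OF assms] ..
  also have "\<dots> = tilted_char (u / sqrt n) (t / sqrt n) ^ n"
    using mgf_bounds(1)[of "u / sqrt n"] by (simp add: scaleR_conv_of_real power_mult_distrib)
  finally show ?thesis .
qed

lemma integrable_tilted_law_id: "integrable (tilted_law n u) (\<lambda>x. x)"
proof -
  let ?m = "mgf (u / sqrt n) ^ n"
  have m: "0 < ?m" by (rule mgf_power_pos)
  have b: "\<bar>exp (u * x) / ?m * (x - u)\<bar> \<le> exp (- u) / ?m * exp ((u + 1) * x) + exp u / ?m * exp ((u - 1) * x)" for x
  proof -
    have "\<bar>x - u\<bar> \<le> exp (x - u) + exp (u - x)"
      using exp_ge_add_one_self[of "x - u"] exp_ge_add_one_self[of "u - x"] exp_gt_zero[of "x - u"] exp_gt_zero[of "u - x"]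
      by linarith
    then have "exp (u * x) / ?m * \<bar>x - u\<bar> \<le> exp (u * x) / ?m * (exp (x - u) + exp (u - x))"
      using m by (intro mult_left_mono) auto
    also have "\<dots> = (exp (u * x) * exp (x - u)) / ?m + (exp (u * x) * exp (u - x)) / ?m"
      by (simp add: distrib_left)
    also have "\<dots> = (exp (- u) * exp ((u + 1) * x)) / ?m + (exp u * exp ((u - 1) * x)) / ?m"
      unfolding exp_add[symmetric] by (simp add: algebra_simps)
    finally show ?thesis using m by (simp add: abs_mult)
  qed
  have "integrable (sum_law n) (\<lambda>x. (exp (u * x) / ?m) *\<^sub>R (x - u))"
  proof (rule Bochner_Integration.integrable_bound)
    show "integrable (sum_law n) (\<lambda>x. exp (- u) / ?m * exp ((u + 1) * x) + exp u / ?m * exp ((u - 1) * x))"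
      by (intro Bochner_Integration.integrable_add integrable_mult_right integrable_sum_law_exp)
    show "AE x in sum_law n. norm ((exp (u * x) / ?m) *\<^sub>R (x - u))
        \<le> norm (exp (- u) / ?m * exp ((u + 1) * x) + exp u / ?m * exp ((u - 1) * x))"
      using b by (intro AE_I2) (simp only: real_norm_def real_scaleR_def, rule order_trans[OF b abs_ge_self])
  qed simp
  then show ?thesis
    by (subst integral_tilted_law) auto
qed

lemma sum_law_tail_tilt:
  "measure (sum_law n) {u<..}
    = mgf (u / sqrt n) ^ n * exp (- u\<^sup>2) * (\<integral>y. indicator {0<..} y * exp (- (u * y)) \<partial>tilted_law n u)"
proof -
  let ?m = "mgf (u / sqrt n) ^ n"
  interpret F: real_distribution "sum_law n" by (rule real_distribution_sum_law)
  have m: "0 < ?m" by (rule mgf_power_pos)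
  have "?m * exp (- u\<^sup>2) * (\<integral>y. indicator {0<..} y * exp (- (u * y)) \<partial>tilted_law n u)
     = ?m * exp (- u\<^sup>2) * (\<integral>x. (exp (u * x) / ?m) * (indicator {0<..} (x - u) * exp (- (u * (x - u)))) \<partial>sum_law n)"
    by (subst integral_tilted_law) auto
  also have "\<dots> = (\<integral>x. ?m * exp (- u\<^sup>2) * ((exp (u * x) / ?m) * (indicator {0<..} (x - u) * exp (- (u * (x - u))))) \<partial>sum_law n)"
    by (rule integral_mult_right_zero[symmetric])
  also have "\<dots> = (\<integral>x. indicator {u<..} x \<partial>sum_law n)"
  proof (intro Bochner_Integration.integral_cong refl)
    fix x
    have "exp (- u\<^sup>2) * exp (u * x) * exp (- (u * (x - u))) = 1"
      unfolding exp_add[symmetric] by (simp add: algebra_simps power2_eq_square)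
    then have "?m * exp (- u\<^sup>2) * ((exp (u * x) / ?m) * exp (- (u * (x - u)))) = 1"
      using mgf_bounds(1)[of "u / sqrt n"] by (auto simp: mult_ac)
    then show "?m * exp (- u\<^sup>2) * ((exp (u * x) / ?m) * (indicator {0<..} (x - u) * exp (- (u * (x - u))))) = indicator {u<..} x"
      by (cases "u < x") (simp_all add: mult_ac)
  qed
  also have "\<dots> = measure (sum_law n) {u<..}"
    by simp
  finally show ?thesis ..
qed

lemma sum_law_mgf_le: "1 \<le> n \<Longrightarrow> mgf (u / sqrt n) ^ n \<le> exp (u\<^sup>2 / 2)"
proof -
  assume n: "1 \<le> n"
  have "mgf (u / sqrt n) ^ n \<le> exp ((u / sqrt n)\<^sup>2 / 2) ^ n"
    using mgf_bounds[of "u / sqrt n"] by (intro power_mono) auto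
  also have "\<dots> = exp (u\<^sup>2 / 2)"
    using n by (simp add: power_divide flip: exp_of_nat_mult)
  finally show ?thesis .
qed

text \<open>
  Chernoff's bound, obtained from the tilting identity since the remaining integrand is at most $1$.
\<close>

lemma sum_law_tail_le:
  assumes "1 \<le> n" "0 \<le> u"
  shows "measure (sum_law n) {u<..} \<le> exp (- u\<^sup>2 / 2)"
proof -
  interpret T: real_distribution "tilted_law n u" by (rule real_distribution_tilted_law)
  let ?I = "\<integral>y. indicator {0<..} y * exp (- (u * y)) \<partial>tilted_law n u"
  have int: "integrable (tilted_law n u) (\<lambda>y. indicator {0<..} y * exp (- (u * y)))"
    by (rule T.integrable_const_bound[where B = 1]) (use assms in \<open>auto simp: indicator_def\<close>)
  have "?I \<le> (\<integral>y. 1 \<partial>tilted_law n u)"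
    by (intro integral_mono int) (use assms in \<open>auto simp: indicator_def\<close>)
  then have "?I \<le> 1"
    using T.prob_space by simp
  moreover have "0 \<le> ?I"
    by (intro Bochner_Integration.integral_nonneg) auto
  ultimately have "measure (sum_law n) {u<..} \<le> exp (u\<^sup>2 / 2) * exp (- u\<^sup>2) * 1"
    unfolding sum_law_tail_tilt using sum_law_mgf_le[OF assms(1), of u] by (intro mult_mono) auto
  also have "\<dots> = exp (- u\<^sup>2 / 2)"
    by (simp flip: exp_add)
  finally show ?thesis .
qed

text \<open>
  A Berry-Esseen estimate for the tilted sum: the smoothing inequality on the interval $|t| \le \sqrt n/600$, on
  which the Taylor estimates for the characteristic function hold.
\<close>

lemma tilted_law_close_to_normal:
  assumes n: "1 \<le> n" and u: "0 \<le> u" "u\<^sup>2 \<le> sqrt n" "u \<le> sqrt n / 600"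
  shows "\<bar>measure (tilted_law n u) {a<..} - measure std_normal_distribution {a<..}\<bar> \<le> 21840 * exp 15376 * (1 + u\<^sup>2) / sqrt n"
proof -
  let ?E = "exp 15376 :: real"
  have n0: "0 < sqrt n" using n by simp
  have C: "char (tilted_law n u) t = tilted_char (u / sqrt n) (t / sqrt n) ^ n" for t
    by (rule char_tilted_law[OF n])
  have N: "char std_normal_distribution t = complex_of_real (exp (- t\<^sup>2 / 2))" for t
    by (simp add: char_std_normal_distribution)
  have "\<bar>measure (tilted_law n u) {a<..} - measure std_normal_distribution {a<..}\<bar>
      \<le> 240 * ?E * (1 + u\<^sup>2) / sqrt n + 36 * ?E / (sqrt n / 600)"
  proof (rule smoothing_inequality)
    show "real_distribution (tilted_law n u)" by (rule real_distribution_tilted_law)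
    show "real_distribution std_normal_distribution" by (rule real_dist_normal_dist)
    show "integrable (tilted_law n u) (\<lambda>x. x)" by (rule integrable_tilted_law_id)
    show "integrable std_normal_distribution (\<lambda>x. x)"
      using integrable_std_normal_distribution_moment[of 1] by simp
    show "0 < sqrt n / 600" using n0 by simp
    fix t :: real assume t: "\<bar>t\<bar> \<le> sqrt n / 600"
    show "cmod (char (tilted_law n u) t - char std_normal_distribution t)
        \<le> 240 * ?E * (1 + u\<^sup>2) / sqrt n * \<bar>t\<bar> / (1 + \<bar>t\<bar>)\<^sup>2"
      unfolding C N by (rule tilted_char_power(2)[OF n u t])
    show "cmod (char (tilted_law n u) t) \<le> ?E / (1 + \<bar>t\<bar>)\<^sup>2"
      unfolding C by (rule tilted_char_power(1)[OF n u t])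
    have "- t\<^sup>2 / 2 \<le> - t\<^sup>2 / 4 + 120 * \<bar>t\<bar>"
      using zero_le_power2[of t] abs_ge_zero[of t] by linarith
    then have "(1 + \<bar>t\<bar>)\<^sup>2 * exp (- t\<^sup>2 / 2) \<le> (1 + \<bar>t\<bar>) ^ 4 * exp (- t\<^sup>2 / 4 + 120 * \<bar>t\<bar>)"
      by (intro mult_mono power_increasing) auto
    also have "\<dots> \<le> ?E" by (rule gaussian_beats_polynomial)
    finally show "cmod (char std_normal_distribution t) \<le> ?E / (1 + \<bar>t\<bar>)\<^sup>2"
      unfolding N norm_of_real abs_exp_cancel
      by (subst pos_le_divide_eq) (auto simp: mult.commute intro!: zero_less_power add_pos_nonneg)
  qed
  also have "\<dots> \<le> 21840 * ?E * (1 + u\<^sup>2) / sqrt n"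
  proof -
    have "36 * ?E / (sqrt n / 600) = 21600 * ?E * 1 / sqrt n" by simp
    also have "\<dots> \<le> 21600 * ?E * (1 + u\<^sup>2) / sqrt n"
      using n0 by (intro divide_right_mono mult_left_mono) auto
    finally have "36 * ?E / (sqrt n / 600) \<le> 21600 * (?E * (1 + u\<^sup>2) / sqrt n)" by simp
    moreover have "240 * ?E * (1 + u\<^sup>2) / sqrt n = 240 * (?E * (1 + u\<^sup>2) / sqrt n)"
      "21840 * ?E * (1 + u\<^sup>2) / sqrt n = 21840 * (?E * (1 + u\<^sup>2) / sqrt n)" by simp_all
    ultimately show ?thesis by linarith
  qed
  finally show ?thesis .
qed

text \<open>
  If $(1+u^2)/\sqrt n \ge 1/360000$, the right-hand side exceeds $e^{-u^2/2}$, which bounds both tails. Otherwise $u$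
  lies in the range of the Berry-Esseen estimate for the tilted law. There, with $I$ and $I_0$ the integrals of
  $e^{-uy}$ over $y > 0$ under the tilted and under the normal law, the difference of the tails is
  $r e^{-u^2/2} (I - I_0) - (1-r) P(N > u)$. The factor $u^3$ in $1 - r$ becomes $u^2$ because
  $u P(N > u) \le e^{-u^2/2}$.
\<close>

lemma normal_approximation:
  assumes n: "1 \<le> n" and u: "0 \<le> u"
  shows "\<bar>measure (sum_law n) {u<..} - normal_tail u\<bar>
    \<le> 360000 * exp 15376 / sqrt n * (1 + u\<^sup>2) * exp (- u\<^sup>2 / 2)"
proof -
  define E where "E = (exp 15376 :: real)"
  have E: "1 \<le> E" by (simp add: E_def)
  have n0: "0 < sqrt n" using n by simp
  show ?thesis
  proof (cases "1 / 360000 \<le> (1 + u\<^sup>2) / sqrt n")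
    case True
    interpret F: real_distribution "sum_law n" by (rule real_distribution_sum_law)
    have "0 \<le> measure (sum_law n) {u<..}" "0 \<le> normal_tail u"
      by (auto simp: normal_tail_def)
    then have "\<bar>measure (sum_law n) {u<..} - normal_tail u\<bar> \<le> 1 * exp (- u\<^sup>2 / 2)"
      using sum_law_tail_le[OF n u] normal_tail_bounds(1)[OF u] by linarith
    moreover have "1 \<le> 360000 * ((1 + u\<^sup>2) / sqrt n)"
      using True by linarith
    moreover have "1 * ((1 + u\<^sup>2) / sqrt n) \<le> E * ((1 + u\<^sup>2) / sqrt n)"
      using E n0 by (intro mult_right_mono) auto
    ultimately have "1 \<le> 360000 * (E * ((1 + u\<^sup>2) / sqrt n))" by linarith
    then have "1 * exp (- u\<^sup>2 / 2) \<le> 360000 * (E * ((1 + u\<^sup>2) / sqrt n)) * exp (- u\<^sup>2 / 2)"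
      by (rule mult_right_mono) simp
    also have "\<dots> = 360000 * E / sqrt n * (1 + u\<^sup>2) * exp (- u\<^sup>2 / 2)"
      by simp
    finally show ?thesis
      using \<open>\<bar>measure (sum_law n) {u<..} - normal_tail u\<bar> \<le> 1 * exp (- u\<^sup>2 / 2)\<close> unfolding E_def by linarith
  next
    case False
    then have small: "1 + u\<^sup>2 \<le> sqrt n / 360000"
      using n0 by (simp add: field_simps)
    have u2: "u\<^sup>2 \<le> sqrt n"
      using small n0 by linarith
    have "1 \<le> sqrt n" using n by simp
    have "u \<le> sqrt n / 600"
    proof (rule power2_le_imp_le)
      have "u\<^sup>2 \<le> sqrt n * 1 / 360000" using small by simp
      also have "\<dots> \<le> sqrt n * sqrt n / 360000"
        using \<open>1 \<le> sqrt n\<close> by (intro divide_right_mono mult_left_mono) auto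
      finally show "u\<^sup>2 \<le> (sqrt n / 600)\<^sup>2"
        by (simp add: power2_eq_square)
    qed (use n0 in simp)
    note close = tilted_law_close_to_normal[OF n u u2 this, folded E_def]
    let ?m = "mgf (u / sqrt n) ^ n"
    let ?I = "\<lambda>M. \<integral>y. indicator {0<..} y * exp (- (u * y)) \<partial>M"
    have cmp: "\<bar>?I (tilted_law n u) - ?I std_normal_distribution\<bar> \<le> 2 * (21840 * E * (1 + u\<^sup>2) / sqrt n)"
      by (rule tail_comparison_exp[OF real_distribution_tilted_law real_dist_normal_dist u close])
    define r where "r = ?m * exp (- u\<^sup>2 / 2)"
    have r: "0 \<le> r" "r \<le> 1" "1 - r \<le> 46 * u ^ 3 / sqrt n"
    proof -
      show "0 \<le> r" using mgf_power_pos[of "u / sqrt n" n] by (simp add: r_def)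
      have "r \<le> exp (u\<^sup>2 / 2) * exp (- u\<^sup>2 / 2)"
        unfolding r_def using sum_law_mgf_le[OF n] by (intro mult_right_mono) auto
      then show "r \<le> 1" by (simp flip: exp_add)
      have "real n * \<bar>u / sqrt n\<bar> ^ 3 = u ^ 3 / sqrt n"
        using n0 u by (simp add: power_divide power3_eq_cube)
      moreover have "real n * (u / sqrt n)\<^sup>2 = u\<^sup>2"
        using n by (simp add: power_divide)
      ultimately show "1 - r \<le> 46 * u ^ 3 / sqrt n"
        using mgf_power_lower[of n "u / sqrt n"] unfolding r_def by (simp add: mult.assoc)
    qed
    have e2: "exp (- u\<^sup>2) = exp (- u\<^sup>2 / 2) * exp (- u\<^sup>2 / 2)"
      by (simp flip: exp_add)
    have eq: "measure (sum_law n) {u<..} - normal_tail u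
      = r * exp (- u\<^sup>2 / 2) * (?I (tilted_law n u) - ?I std_normal_distribution) - (1 - r) * normal_tail u"
      unfolding sum_law_tail_tilt normal_tail_tilt[of u] e2 r_def by (simp add: algebra_simps)
    have "\<bar>r * exp (- u\<^sup>2 / 2) * (?I (tilted_law n u) - ?I std_normal_distribution)\<bar>
       = r * exp (- u\<^sup>2 / 2) * \<bar>?I (tilted_law n u) - ?I std_normal_distribution\<bar>"
      using r by (simp add: abs_mult)
    also have "\<dots> \<le> 1 * exp (- u\<^sup>2 / 2) * (2 * (21840 * E * (1 + u\<^sup>2) / sqrt n))"
      using r cmp by (intro mult_mono) auto
    also have "\<dots> = 43680 * (E / sqrt n * (1 + u\<^sup>2) * exp (- u\<^sup>2 / 2))"
    proof -
      have "1 * p * (2 * (21840 * E * w / s)) = 43680 * (E / s * w * p)" for p w s :: real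
        by (simp add: mult_ac)
      then show ?thesis .
    qed
    finally have 1: "\<bar>r * exp (- u\<^sup>2 / 2) * (?I (tilted_law n u) - ?I std_normal_distribution)\<bar>
      \<le> 43680 * (E / sqrt n * (1 + u\<^sup>2) * exp (- u\<^sup>2 / 2))" .
    have nt: "0 \<le> normal_tail u" by (simp add: normal_tail_def)
    have "\<bar>(1 - r) * normal_tail u\<bar> \<le> 46 * u ^ 3 / sqrt n * normal_tail u"
      using mult_right_mono[OF r(3) nt] r nt by (simp add: abs_mult)
    also have "\<dots> = 46 * u\<^sup>2 / sqrt n * (u * normal_tail u)"
      by (simp add: power2_eq_square power3_eq_cube)
    also have "\<dots> \<le> 46 * u\<^sup>2 / sqrt n * exp (- u\<^sup>2 / 2)"
      using n0 by (intro mult_left_mono normal_tail_bounds(2) u) auto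
    also have "\<dots> = 46 * (1 / sqrt n * u\<^sup>2 * exp (- u\<^sup>2 / 2))"
      by simp
    also have "\<dots> \<le> 46 * (E / sqrt n * (1 + u\<^sup>2) * exp (- u\<^sup>2 / 2))"
      using E n0 by (intro mult_left_mono mult_right_mono mult_mono divide_right_mono) auto
    finally have 2: "\<bar>(1 - r) * normal_tail u\<bar> \<le> 46 * (E / sqrt n * (1 + u\<^sup>2) * exp (- u\<^sup>2 / 2))" .
    have "\<bar>measure (sum_law n) {u<..} - normal_tail u\<bar>
      \<le> \<bar>r * exp (- u\<^sup>2 / 2) * (?I (tilted_law n u) - ?I std_normal_distribution)\<bar> + \<bar>(1 - r) * normal_tail u\<bar>"
      unfolding eq by (rule abs_triangle_ineq4)
    also have "\<dots> \<le> 43680 * (E / sqrt n * (1 + u\<^sup>2) * exp (- u\<^sup>2 / 2)) + 46 * (E / sqrt n * (1 + u\<^sup>2) * exp (- u\<^sup>2 / 2))"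
      by (rule add_mono[OF 1 2])
    also have "\<dots> \<le> 360000 * (E / sqrt n * (1 + u\<^sup>2) * exp (- u\<^sup>2 / 2))"
    proof -
      have "0 \<le> E / sqrt n * (1 + u\<^sup>2) * exp (- u\<^sup>2 / 2)"
        using E n0 by simp
      then show ?thesis by linarith
    qed
    finally show ?thesis
      unfolding E_def by simp
  qed
qed

end

section \<open>The quadratic weight and its normalisation\<close>

lemma density_times_exp_linear:
  "std_normal_density g * exp (b * g * x) = exp ((b * x)\<^sup>2 / 2) * normal_density (b * x) 1 g"
  by (simp add: normal_density_def power2_diff exp_add[symmetric] field_simps)

lemma density_times_exp_square:
  assumes "\<beta> < 1"
  shows "std_normal_density g * exp (\<beta> * g\<^sup>2 / 2) = (1 / sqrt (1 - \<beta>)) * normal_density 0 (1 / sqrt (1 - \<beta>)) g"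
proof -
  have c: "0 < 1 - \<beta>" using assms by simp
  have "exp (- g\<^sup>2 / 2) * exp (\<beta> * g\<^sup>2 / 2) = exp (- (g\<^sup>2 / (2 * (1 / sqrt (1 - \<beta>))\<^sup>2)))"
    using c by (simp add: power_divide field_simps flip: exp_add)
  moreover have "sqrt (2 * pi * (1 / sqrt (1 - \<beta>))\<^sup>2) = sqrt (2 * pi) / sqrt (1 - \<beta>)"
    using c by (simp add: power_divide real_sqrt_divide)
  ultimately show ?thesis
    using c by (simp add: normal_density_def)
qed

text \<open>
  The density of the standard normal law times $e^{\beta x^2/2}$ is that density at $\sqrt{1-\beta}\, x$, so a linear
  substitution gives the value.
\<close>

lemma normal_truncated_exp_square:
  assumes "\<beta> < 1"
  shows "integrable std_normal_distribution (\<lambda>x. indicator {t<..} x * exp (\<beta> * x\<^sup>2 / 2))"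
    and "(\<integral>x. indicator {t<..} x * exp (\<beta> * x\<^sup>2 / 2) \<partial>std_normal_distribution)
      = normal_tail (sqrt (1 - \<beta>) * t) / sqrt (1 - \<beta>)"
proof -
  define c where "c = sqrt (1 - \<beta>)"
  have c: "0 < c" "c\<^sup>2 = 1 - \<beta>" using assms by (auto simp: c_def)
  have eq: "std_normal_density x * (indicator {t<..} x * exp (\<beta> * x\<^sup>2 / 2))
      = std_normal_density (0 + c * x) * indicator {c * t<..} (0 + c * x)" for x
  proof -
    have "exp (- x\<^sup>2 / 2) * exp (\<beta> * x\<^sup>2 / 2) = exp (- (c * x)\<^sup>2 / 2)"
      unfolding power_mult_distrib c(2) by (simp add: field_simps flip: exp_add)
    then show ?thesis
      using c(1) by (simp add: std_normal_density_def indicator_def)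
  qed
  have int: "integrable lborel (\<lambda>x. std_normal_density x * indicator {c * t<..} x)"
    by (rule integrable_mult_indicator[where A = "{c * t<..}" and M = lborel and f = std_normal_density, simplified mult.commute real_scaleR_def]) auto
  show "integrable std_normal_distribution (\<lambda>x. indicator {t<..} x * exp (\<beta> * x\<^sup>2 / 2))"
    using lborel_integrable_real_affine_iff[of c "\<lambda>x. std_normal_density x * indicator {c * t<..} x" 0] c int
    by (subst integral_std_normal) (auto simp: eq)
  have "(\<integral>x. indicator {t<..} x * exp (\<beta> * x\<^sup>2 / 2) \<partial>std_normal_distribution)
     = (\<integral>x. std_normal_density (0 + c * x) * indicator {c * t<..} (0 + c * x) \<partial>lborel)"
    by (subst integral_std_normal) (auto simp: eq)
  also have "\<dots> = (\<integral>x. std_normal_density x * indicator {c * t<..} x \<partial>lborel) / c"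
    using c by (subst (2) lborel_integral_real_affine[where c = c and t = 0]) auto
  also have "(\<integral>x. std_normal_density x * indicator {c * t<..} x \<partial>lborel) = (\<integral>x. indicator {c * t<..} x \<partial>std_normal_distribution)"
    by (rule integral_std_normal(1)[symmetric]) simp
  also have "\<dots> = normal_tail (c * t)"
    by (simp add: normal_tail_def)
  finally show "(\<integral>x. indicator {t<..} x * exp (\<beta> * x\<^sup>2 / 2) \<partial>std_normal_distribution)
      = normal_tail (sqrt (1 - \<beta>) * t) / sqrt (1 - \<beta>)"
    by (simp add: c_def)
qed

text \<open>
  The integrand is $K \beta u (1 + u^2) e^{-c u^2/2}$ with $c = 1 - \beta$, which has an elementary antiderivative.
\<close>

lemma error_term_integral:
  fixes \<beta> t K :: real
  assumes \<beta>: "0 < \<beta>" "\<beta> < 1" and t: "0 \<le> t" and K: "0 \<le> K"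
  defines "c \<equiv> 1 - \<beta>"
  shows "has_bochner_integral lborel
    (\<lambda>u. indicator {t..} u * (\<beta> * u * exp (\<beta> * u\<^sup>2 / 2) * (K * (1 + u\<^sup>2) * exp (- u\<^sup>2 / 2))))
    (K * (\<beta> / c) * (1 + t\<^sup>2 + 2 / c) * exp (- c * t\<^sup>2 / 2))"
proof (rule has_bochner_integral_nn_integral)
  have c: "0 < c" using \<beta> by (simp add: c_def)
  let ?F = "\<lambda>u. - (K * (\<beta> / c) * (1 + u\<^sup>2 + 2 / c) * exp (- c * u\<^sup>2 / 2))"
  let ?f = "\<lambda>u. \<beta> * u * exp (\<beta> * u\<^sup>2 / 2) * (K * (1 + u\<^sup>2) * exp (- u\<^sup>2 / 2))"
  have f: "?f u = K * \<beta> * u * (1 + u\<^sup>2) * exp (- c * u\<^sup>2 / 2)" for u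
  proof -
    have "exp (\<beta> * u\<^sup>2 / 2) * exp (- u\<^sup>2 / 2) = exp (- c * u\<^sup>2 / 2)"
      by (simp add: c_def field_simps flip: exp_add)
    moreover have "?f u = K * \<beta> * u * (1 + u\<^sup>2) * (exp (\<beta> * u\<^sup>2 / 2) * exp (- u\<^sup>2 / 2))"
      by (simp only: mult_ac)
    ultimately show ?thesis by simp
  qed
  have D: "(?F has_real_derivative ?f u) (at u)" for u
    unfolding f using c by (auto intro!: derivative_eq_intros simp: field_simps)
  have lim: "(?F \<longlongrightarrow> 0) at_top"
    using c \<beta> by real_asymp
  have nonneg: "0 \<le> ?f u" if "t \<le> u" for u
    using that t \<beta> K by (intro mult_nonneg_nonneg) auto
  have "(\<integral>\<^sup>+u. ennreal (?f u) * indicator {t..} u \<partial>lborel) = ennreal (0 - ?F t)"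
    by (rule nn_integral_FTC_atLeast[where F = ?F]) (use D nonneg lim in auto)
  also have "(\<integral>\<^sup>+u. ennreal (?f u) * indicator {t..} u \<partial>lborel) = (\<integral>\<^sup>+u. ennreal (indicator {t..} u * ?f u) \<partial>lborel)"
    by (intro nn_integral_cong) (auto simp: indicator_def)
  finally show "(\<integral>\<^sup>+u. ennreal (indicator {t..} u * ?f u) \<partial>lborel) = ennreal (K * (\<beta> / c) * (1 + t\<^sup>2 + 2 / c) * exp (- c * t\<^sup>2 / 2))"
    by simp
  show "0 \<le> K * (\<beta> / c) * (1 + t\<^sup>2 + 2 / c) * exp (- c * t\<^sup>2 / 2)"
    using c \<beta> K by simp
  show "AE u in lborel. 0 \<le> indicator {t..} u * ?f u"
    using nonneg by (intro AE_I2) (simp add: indicator_def)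
qed simp

context standard_subgaussian
begin

lemma borel_measurable_mgf [measurable]: "mgf \<in> borel_measurable borel"
  unfolding mgf_def[abs_def] by measurable

text \<open>
  The square in the exponent is linearised by an auxiliary normal variable $g$, using
  $e^{\beta x^2/2} = E[e^{\sqrt\beta g x}]$; given $g$, the coordinates are independent again.
\<close>

lemma Hubbard_Stratonovich:
  assumes \<beta>: "0 \<le> \<beta>"
  shows "(\<integral>\<^sup>+x. ennreal (exp (\<beta> * x\<^sup>2 / 2)) \<partial>sum_law n)
    = (\<integral>\<^sup>+g. ennreal (std_normal_density g * mgf (sqrt \<beta> * g / sqrt n) ^ n) \<partial>lborel)"
proof -
  interpret F: real_distribution "sum_law n" by (rule real_distribution_sum_law)
  interpret P: pair_sigma_finite "sum_law n" lborel ..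
  define f where "f x g = ennreal (std_normal_density g * exp (sqrt \<beta> * g * x))" for x g
  have [measurable]: "(\<lambda>(x, g). f x g) \<in> borel_measurable (sum_law n \<Otimes>\<^sub>M lborel)"
    unfolding f_def by measurable
  have inner: "(\<integral>\<^sup>+g. f x g \<partial>lborel) = ennreal (exp (\<beta> * x\<^sup>2 / 2))" for x
  proof -
    have "(\<integral>\<^sup>+g. f x g \<partial>lborel) = ennreal (\<integral>g. exp ((sqrt \<beta> * x)\<^sup>2 / 2) * normal_density (sqrt \<beta> * x) 1 g \<partial>lborel)"
      unfolding f_def density_times_exp_linear
      by (intro nn_integral_eq_integral integrable_mult_right integrable_normal_density) auto
    then show ?thesis
      using \<beta> by (simp add: power_mult_distrib)
  qed
  have outer: "(\<integral>\<^sup>+x. f x g \<partial>sum_law n) = ennreal (std_normal_density g * mgf (sqrt \<beta> * g / sqrt n) ^ n)" for g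
  proof -
    have "(\<integral>\<^sup>+x. f x g \<partial>sum_law n) = ennreal (\<integral>x. std_normal_density g * exp (sqrt \<beta> * g * x) \<partial>sum_law n)"
      unfolding f_def
      by (intro nn_integral_eq_integral integrable_mult_right integrable_sum_law_exp) auto
    then show ?thesis
      by (simp add: integral_sum_law_exp)
  qed
  show ?thesis
    unfolding inner[symmetric] outer[symmetric] by (rule P.Fubini'[symmetric]) measurable
qed

text \<open>
  In the Hubbard-Stratonovich representation the power $M(\sqrt\beta g/\sqrt n)^n$ lies between
  $e^{\beta g^2/2} (1 - 46 |g|^3/\sqrt n)$ and $e^{\beta g^2/2}$. The upper bound integrates to
  $\kappa = (1-\beta)^{-1/2}$, and the difference to the third absolute moment \<open>m3\<close> of the normal law with standard
  deviation $\kappa$.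
\<close>

lemma exp_square_moment:
  assumes \<beta>: "0 < \<beta>" "\<beta> < 1" and n: "1 \<le> n"
  defines "\<kappa> \<equiv> 1 / sqrt (1 - \<beta>)"
  defines "m3 \<equiv> (\<integral>g. normal_density 0 \<kappa> g * \<bar>g\<bar> ^ 3 \<partial>lborel)"
  shows "integrable (sum_law n) (\<lambda>x. exp (\<beta> * x\<^sup>2 / 2))"
    and "(\<integral>x. exp (\<beta> * x\<^sup>2 / 2) \<partial>sum_law n) \<le> \<kappa>"
    and "1 \<le> (\<integral>x. exp (\<beta> * x\<^sup>2 / 2) \<partial>sum_law n)"
    and "\<kappa> - 46 * \<kappa> * m3 / sqrt n \<le> (\<integral>x. exp (\<beta> * x\<^sup>2 / 2) \<partial>sum_law n)"
proof -
  interpret F: real_distribution "sum_law n" by (rule real_distribution_sum_law)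
  let ?Z = "\<integral>x. exp (\<beta> * x\<^sup>2 / 2) \<partial>sum_law n"
  let ?h = "\<lambda>g. std_normal_density g * mgf (sqrt \<beta> * g / sqrt n) ^ n"
  let ?H = "\<lambda>g. \<kappa> * normal_density 0 \<kappa> g"
  have n0: "0 < sqrt n" using n by simp
  have \<kappa>: "0 < \<kappa>" using \<beta> by (simp add: \<kappa>_def)
  have H: "std_normal_density g * exp (\<beta> * g\<^sup>2 / 2) = ?H g" for g
    unfolding \<kappa>_def by (rule density_times_exp_square[OF \<beta>(2)])
  have sq: "real n * (sqrt \<beta> * g / sqrt n)\<^sup>2 = \<beta> * g\<^sup>2" for g
    using \<beta> n by (simp add: power_divide power_mult_distrib)
  have intH: "integrable lborel ?H"
    using \<kappa> by (intro integrable_mult_right integrable_normal_density)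
  have hH: "?h g \<le> ?H g" for g
  proof -
    have "mgf (sqrt \<beta> * g / sqrt n) ^ n \<le> exp ((sqrt \<beta> * g)\<^sup>2 / 2)"
      by (rule sum_law_mgf_le[OF n])
    also have "(sqrt \<beta> * g)\<^sup>2 = \<beta> * g\<^sup>2"
      using \<beta> by (simp add: power_mult_distrib)
    finally have "?h g \<le> std_normal_density g * exp (\<beta> * g\<^sup>2 / 2)"
      by (rule mult_left_mono) simp
    then show ?thesis
      unfolding H .
  qed
  have h0: "0 \<le> ?h g" for g
    using mgf_power_pos[of "sqrt \<beta> * g / sqrt n" n] by simp
  have inth: "integrable lborel ?h"
  proof (rule Bochner_Integration.integrable_bound[OF intH])
    show "AE g in lborel. norm (?h g) \<le> norm (?H g)"
      using hH h0 by (intro AE_I2) (simp only: real_norm_def abs_of_nonneg[OF h0], rule order_trans[OF hH abs_ge_self])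
  qed simp
  have "(\<integral>\<^sup>+x. ennreal (exp (\<beta> * x\<^sup>2 / 2)) \<partial>sum_law n) = ennreal (\<integral>g. ?h g \<partial>lborel)"
    using \<beta> by (subst Hubbard_Stratonovich) (auto intro!: nn_integral_eq_integral inth h0)
  then have hb: "has_bochner_integral (sum_law n) (\<lambda>x. exp (\<beta> * x\<^sup>2 / 2)) (\<integral>g. ?h g \<partial>lborel)"
    by (intro has_bochner_integral_nn_integral) (auto intro!: Bochner_Integration.integral_nonneg h0)
  then show int: "integrable (sum_law n) (\<lambda>x. exp (\<beta> * x\<^sup>2 / 2))"
    by (simp add: has_bochner_integral_iff)
  have Z: "?Z = (\<integral>g. ?h g \<partial>lborel)"
    using hb by (simp add: has_bochner_integral_iff)
  have "(\<integral>g. ?h g \<partial>lborel) \<le> (\<integral>g. ?H g \<partial>lborel)"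
    by (intro integral_mono inth intH hH)
  then show "?Z \<le> \<kappa>"
    using \<kappa> unfolding Z by simp
  have "(\<integral>x. 1 \<partial>sum_law n) \<le> ?Z"
    using \<beta> by (intro integral_mono int) auto
  then show "1 \<le> ?Z"
    using F.prob_space by simp
  have int3: "integrable lborel (\<lambda>g. normal_density 0 \<kappa> g * \<bar>g\<bar> ^ 3)"
    using integrable_normal_moment_abs[OF \<kappa>, of 0 3] by simp
  have "(\<integral>g. ?H g - 46 * \<kappa> / sqrt n * (normal_density 0 \<kappa> g * \<bar>g\<bar> ^ 3) \<partial>lborel) \<le> (\<integral>g. ?h g \<partial>lborel)"
  proof (rule integral_mono[OF _ inth])
    show "integrable lborel (\<lambda>g. ?H g - 46 * \<kappa> / sqrt n * (normal_density 0 \<kappa> g * \<bar>g\<bar> ^ 3))"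
      by (intro Bochner_Integration.integrable_diff intH integrable_mult_right int3)
    fix g
    have "real n * \<bar>sqrt \<beta> * g / sqrt n\<bar> ^ 3 = sqrt \<beta> ^ 3 * \<bar>g\<bar> ^ 3 / sqrt n"
    proof -
      have "r * r * (b * a / r) ^ 3 = b ^ 3 * a ^ 3 / r" if "0 < r" for a b r :: real
        using that by (simp add: field_simps power3_eq_cube)
      from this[OF n0, of "sqrt \<beta>" "\<bar>g\<bar>"] show ?thesis
        using \<beta> by (simp add: abs_mult abs_divide)
    qed
    also have "\<dots> \<le> 1 * \<bar>g\<bar> ^ 3 / sqrt n"
      using \<beta> n0 by (intro divide_right_mono mult_right_mono power_le_one) auto
    finally have 1: "1 - 46 * \<bar>g\<bar> ^ 3 / sqrt n \<le> 1 - 46 * real n * \<bar>sqrt \<beta> * g / sqrt n\<bar> ^ 3"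
      by simp
    have "1 - 46 * \<bar>g\<bar> ^ 3 / sqrt n \<le> mgf (sqrt \<beta> * g / sqrt n) ^ n * exp (- real n * (sqrt \<beta> * g / sqrt n)\<^sup>2 / 2)"
      by (rule order_trans[OF 1 mgf_power_lower])
    also have "- real n * (sqrt \<beta> * g / sqrt n)\<^sup>2 / 2 = - (\<beta> * g\<^sup>2 / 2)"
      using sq[of g] by simp
    finally have 2: "1 - 46 * \<bar>g\<bar> ^ 3 / sqrt n \<le> mgf (sqrt \<beta> * g / sqrt n) ^ n * exp (- (\<beta> * g\<^sup>2 / 2))" .
    have "?H g - 46 * \<kappa> / sqrt n * (normal_density 0 \<kappa> g * \<bar>g\<bar> ^ 3) = ?H g * (1 - 46 * \<bar>g\<bar> ^ 3 / sqrt n)"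
      by (simp add: algebra_simps)
    also have "\<dots> \<le> ?H g * (mgf (sqrt \<beta> * g / sqrt n) ^ n * exp (- (\<beta> * g\<^sup>2 / 2)))"
      using \<kappa> by (intro mult_left_mono 2) auto
    also have "\<dots> = ?h g * (exp (\<beta> * g\<^sup>2 / 2) * exp (- (\<beta> * g\<^sup>2 / 2)))"
      unfolding H[symmetric] by simp
    also have "\<dots> = ?h g"
      by (simp flip: exp_add)
    finally show "?H g - 46 * \<kappa> / sqrt n * (normal_density 0 \<kappa> g * \<bar>g\<bar> ^ 3) \<le> ?h g" .
  qed
  also have "(\<integral>g. ?H g - 46 * \<kappa> / sqrt n * (normal_density 0 \<kappa> g * \<bar>g\<bar> ^ 3) \<partial>lborel) = \<kappa> - 46 * \<kappa> / sqrt n * m3"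
    using \<kappa> int3 by (subst Bochner_Integration.integral_diff[OF intH]) (auto simp: m3_def)
  finally show "\<kappa> - 46 * \<kappa> * m3 / sqrt n \<le> ?Z"
    unfolding Z by simp
qed

text \<open>
  The tail comparison with the weight $g(x) = e^{\beta x^2/2}$ and the error of the normal approximation. The powers of $z$
  are collected by $t^2 = z^2/c$, $e^{-z^2/2} \le 24 (1+z) (1 - \Phi(z))$ and $(1+z)(1+z^2) \le 4 (1+z^3)$.
\<close>

lemma truncated_exp_square_moment:
  assumes \<beta>: "0 < \<beta>" "\<beta> < 1" and n: "1 \<le> n" and z: "0 \<le> z"
  defines "t \<equiv> z / sqrt (1 - \<beta>)"
  shows "\<bar>(\<integral>x. indicator {t<..} x * exp (\<beta> * x\<^sup>2 / 2) \<partial>sum_law n) - normal_tail z / sqrt (1 - \<beta>)\<bar>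
    \<le> 138240000 * exp 15376 / (1 - \<beta>)\<^sup>2 / sqrt n * (1 + z ^ 3) * normal_tail z"
proof -
  define c where "c = 1 - \<beta>"
  define K where "K = 360000 * exp 15376 / sqrt n"
  have c: "0 < c" "c \<le> 1" using \<beta> by (auto simp: c_def)
  have K: "0 \<le> K" by (simp add: K_def)
  have t: "0 \<le> t" "c * t\<^sup>2 = z\<^sup>2" "t\<^sup>2 = z\<^sup>2 / c"
    using z c by (auto simp: t_def c_def power_divide)
  note F = real_distribution_sum_law[of n]
  have int: "integrable (sum_law n) (\<lambda>x. indicator {t<..} x * exp (\<beta> * x\<^sup>2 / 2))"
    using integrable_mult_indicator[OF _ exp_square_moment(1)[OF \<beta> n], of "{t<..}"] by simp
  have N: "(\<integral>x. indicator {t<..} x * exp (\<beta> * x\<^sup>2 / 2) \<partial>std_normal_distribution) = normal_tail z / sqrt (1 - \<beta>)"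
    using \<beta> by (subst normal_truncated_exp_square) (auto simp: t_def)
  note E = error_term_integral[OF \<beta> t(1) K, folded c_def]
  have "\<bar>(\<integral>x. indicator {t<..} x * exp (\<beta> * x\<^sup>2 / 2) \<partial>sum_law n)
      - (\<integral>x. indicator {t<..} x * exp (\<beta> * x\<^sup>2 / 2) \<partial>std_normal_distribution)\<bar>
    \<le> exp (\<beta> * t\<^sup>2 / 2) * (K * (1 + t\<^sup>2) * exp (- t\<^sup>2 / 2))
      + (\<integral>u. indicator {t..} u * (\<beta> * u * exp (\<beta> * u\<^sup>2 / 2) * (K * (1 + u\<^sup>2) * exp (- u\<^sup>2 / 2))) \<partial>lborel)"
  proof (rule tail_comparison[OF F real_dist_normal_dist])
    show "\<bar>measure (sum_law n) {u<..} - measure std_normal_distribution {u<..}\<bar> \<le> K * (1 + u\<^sup>2) * exp (- u\<^sup>2 / 2)"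
      if "t \<le> u" for u
      using normal_approximation[OF n, of u] that t(1) by (simp add: K_def normal_tail_def)
    show "((\<lambda>x. exp (\<beta> * x\<^sup>2 / 2)) has_real_derivative \<beta> * x * exp (\<beta> * x\<^sup>2 / 2)) (at x)" for x
      by (auto intro!: derivative_eq_intros)
    show "0 \<le> \<beta> * x * exp (\<beta> * x\<^sup>2 / 2)" if "t \<le> x" for x
      using that t \<beta> by simp
    show "integrable std_normal_distribution (\<lambda>x. indicator {t<..} x * exp (\<beta> * x\<^sup>2 / 2))"
      by (rule normal_truncated_exp_square[OF \<beta>(2)])
    show "integrable lborel (\<lambda>u. indicator {t..} u * (\<beta> * u * exp (\<beta> * u\<^sup>2 / 2) * (K * (1 + u\<^sup>2) * exp (- u\<^sup>2 / 2))))"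
      using E by (simp add: has_bochner_integral_iff)
  qed (use int in auto)
  also have "\<dots> = K * exp (- z\<^sup>2 / 2) * ((1 + t\<^sup>2) + \<beta> / c * (1 + t\<^sup>2 + 2 / c))"
  proof -
    have "exp (\<beta> * t\<^sup>2 / 2) * exp (- t\<^sup>2 / 2) = exp (- c * t\<^sup>2 / 2)"
      by (simp add: c_def field_simps flip: exp_add)
    then have 1: "exp (\<beta> * t\<^sup>2 / 2) * (K * (1 + t\<^sup>2) * exp (- t\<^sup>2 / 2)) = K * exp (- z\<^sup>2 / 2) * (1 + t\<^sup>2)"
      using t(2) by simp
    have 2: "exp (- c * t\<^sup>2 / 2) = exp (- z\<^sup>2 / 2)"
      using t(2) by simp
    show ?thesis
      unfolding 1 has_bochner_integral_integral_eq[OF E] 2 by (simp add: algebra_simps)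
  qed
  also have "\<dots> \<le> K * exp (- z\<^sup>2 / 2) * (4 / c\<^sup>2 * (1 + z\<^sup>2))"
  proof (rule mult_left_mono)
    have c1: "1 \<le> 1 / c" "1 / c \<le> 1 / c\<^sup>2"
      using c by (auto simp: field_simps power2_eq_square)
    have s: "1 + t\<^sup>2 \<le> 1 / c * (1 + z\<^sup>2)"
      using c1 t(3) by (simp add: algebra_simps)
    also have "\<dots> \<le> 1 / c\<^sup>2 * (1 + z\<^sup>2)"
      using c1 by (intro mult_right_mono) auto
    finally have 1: "1 + t\<^sup>2 \<le> 1 / c\<^sup>2 * (1 + z\<^sup>2)" .
    have "2 / c * 1 \<le> 2 / c * (1 + z\<^sup>2)"
      using c by (intro mult_left_mono) auto
    then have "1 + t\<^sup>2 + 2 / c \<le> 3 / c * (1 + z\<^sup>2)"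
      using s by (simp add: add_divide_distrib distrib_left)
    then have "\<beta> / c * (1 + t\<^sup>2 + 2 / c) \<le> 1 / c * (3 / c * (1 + z\<^sup>2))"
      using c \<beta> by (intro mult_mono divide_right_mono) auto
    also have "\<dots> = 3 / c\<^sup>2 * (1 + z\<^sup>2)"
      by (simp add: power2_eq_square)
    finally have "(1 + t\<^sup>2) + \<beta> / c * (1 + t\<^sup>2 + 2 / c) \<le> 1 / c\<^sup>2 * (1 + z\<^sup>2) + 3 / c\<^sup>2 * (1 + z\<^sup>2)"
      by (rule add_mono[OF 1])
    also have "\<dots> = 4 / c\<^sup>2 * (1 + z\<^sup>2)"
      by (simp add: distrib_right[symmetric] add_divide_distrib[symmetric])
    finally show "(1 + t\<^sup>2) + \<beta> / c * (1 + t\<^sup>2 + 2 / c) \<le> 4 / c\<^sup>2 * (1 + z\<^sup>2)" .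
  qed (use K in simp)
  also have "\<dots> \<le> K * (24 * (1 + z) * normal_tail z) * (4 / c\<^sup>2 * (1 + z\<^sup>2))"
    using K c normal_tail_bounds(3)[OF z] by (intro mult_right_mono mult_left_mono) auto
  also have "\<dots> = K * (96 / c\<^sup>2) * normal_tail z * ((1 + z) * (1 + z\<^sup>2))"
    by (simp add: algebra_simps add_divide_distrib)
  also have "\<dots> \<le> K * (96 / c\<^sup>2) * normal_tail z * (4 * (1 + z ^ 3))"
  proof (rule mult_left_mono)
    have "z \<le> 1 + z ^ 3" "z\<^sup>2 \<le> 1 + z ^ 3"
    proof -
      show "z \<le> 1 + z ^ 3"
        using z power_increasing[of 1 3 z] by (cases "z \<le> 1") (auto intro: add_increasing2)
      show "z\<^sup>2 \<le> 1 + z ^ 3"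
      proof (cases "z \<le> 1")
        case True
        then show ?thesis
          using power_le_one[OF z, of 2] zero_le_power[OF z, of 3] by linarith
      next
        case False
        then have "z\<^sup>2 \<le> z ^ 3" by (intro power_increasing) auto
        then show ?thesis by linarith
      qed
    qed
    moreover have "1 + z + p + q \<le> 4 * (1 + q)" if "z \<le> 1 + q" "p \<le> 1 + q" "0 \<le> q" for p q :: real
      using that by simp
    ultimately have "1 + z + z\<^sup>2 + z ^ 3 \<le> 4 * (1 + z ^ 3)"
      using zero_le_power[OF z, of 3] by blast
    moreover have "(1 + z) * (1 + z\<^sup>2) = 1 + z + z\<^sup>2 + z ^ 3"
      by (simp add: algebra_simps power2_eq_square power3_eq_cube)
    ultimately show "(1 + z) * (1 + z\<^sup>2) \<le> 4 * (1 + z ^ 3)"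
      by (simp only:)
    show "0 \<le> K * (96 / c\<^sup>2) * normal_tail z"
      using K by (simp add: normal_tail_def)
  qed
  also have "\<dots> = 138240000 * exp 15376 / c\<^sup>2 / sqrt n * (1 + z ^ 3) * normal_tail z"
    by (simp add: K_def mult_ac)
  finally show ?thesis
    unfolding N c_def .
qed

lemma curie_weiss_tail:
  assumes \<beta>: "0 < \<beta>" "\<beta> < 1" and n: "1 \<le> n"
  shows "measure (curie_weiss \<beta> \<rho> n) {x \<in> space (curie_weiss \<beta> \<rho> n). normalized_sum \<beta> n x > z}
    = (\<integral>x. indicator {z / sqrt (1 - \<beta>)<..} x * exp (\<beta> * x\<^sup>2 / 2) \<partial>sum_law n) / (\<integral>x. exp (\<beta> * x\<^sup>2 / 2) \<partial>sum_law n)"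
proof -
  let ?P = "PiM {1..n} (\<lambda>_. \<rho>)"
  define T where "T x = (\<Sum>i=1..n. x i) / sqrt n" for x :: "nat \<Rightarrow> real"
  have [measurable]: "T \<in> borel_measurable ?P"
    unfolding T_def[abs_def] by (rule measurable_normalized_sum)
  then have [measurable]: "T \<in> borel_measurable (PiM {Suc 0..n} (\<lambda>_. \<rho>))"
    by simp
  have law: "sum_law n = distr ?P borel T"
    by (simp add: sum_law_def T_def[abs_def])
  define t where "t = z / sqrt (1 - \<beta>)"
  define Z where "Z = (\<integral>x. exp (\<beta> * x\<^sup>2 / 2) \<partial>sum_law n)"
  have Z: "1 \<le> Z"
    unfolding Z_def by (rule exp_square_moment(3)[OF \<beta> n])
  have exponent: "\<beta> / (2 * real n) * (\<Sum>i=1..n. x i)\<^sup>2 = \<beta> * (T x)\<^sup>2 / 2" for x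
    using n by (simp add: T_def power_divide)
  have PF: "partition_function \<beta> \<rho> n = Z"
    unfolding partition_function_def exponent Z_def law by (subst integral_distr) auto
  have W: "normalized_sum \<beta> n x > z \<longleftrightarrow> T x \<in> {t<..}" for x
  proof -
    have "normalized_sum \<beta> n x = sqrt (1 - \<beta>) * T x"
      using n \<beta> by (simp add: normalized_sum_def T_def powr_minus powr_half_sqrt field_simps)
    then show ?thesis
      using \<beta> by (simp add: t_def field_simps)
  qed
  have int: "integrable (sum_law n) (\<lambda>x. indicator {t<..} x * exp (\<beta> * x\<^sup>2 / 2))"
    using integrable_mult_indicator[OF _ exp_square_moment(1)[OF \<beta> n], of "{t<..}"] by simp
  then have int': "integrable ?P (\<lambda>x. indicator {t<..} (T x) * exp (\<beta> * (T x)\<^sup>2 / 2))"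
    unfolding law by (subst (asm) integrable_distr_eq) auto
  let ?A = "{x \<in> space ?P. T x \<in> {t<..}}"
  have "emeasure (curie_weiss \<beta> \<rho> n) ?A = (\<integral>\<^sup>+x. ennreal (exp (\<beta> * (T x)\<^sup>2 / 2) / Z) * indicator ?A x \<partial>?P)"
    unfolding curie_weiss_def exponent PF by (subst emeasure_density) auto
  also have "\<dots> = (\<integral>\<^sup>+x. ennreal (indicator {t<..} (T x) * exp (\<beta> * (T x)\<^sup>2 / 2) / Z) \<partial>?P)"
    by (intro nn_integral_cong) (auto simp: indicator_def)
  also have "\<dots> = ennreal (\<integral>x. indicator {t<..} (T x) * exp (\<beta> * (T x)\<^sup>2 / 2) / Z \<partial>?P)"
    using Z by (intro nn_integral_eq_integral integrable_divide int') auto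
  finally have "measure (curie_weiss \<beta> \<rho> n) ?A = (\<integral>x. indicator {t<..} (T x) * exp (\<beta> * (T x)\<^sup>2 / 2) / Z \<partial>?P)"
    using Z by (simp add: measure_def del: integral_divide_zero)
  also have "\<dots> = (\<integral>x. indicator {t<..} (T x) * exp (\<beta> * (T x)\<^sup>2 / 2) \<partial>?P) / Z"
    by simp
  also have "(\<integral>x. indicator {t<..} (T x) * exp (\<beta> * (T x)\<^sup>2 / 2) \<partial>?P) = (\<integral>x. indicator {t<..} x * exp (\<beta> * x\<^sup>2 / 2) \<partial>sum_law n)"
    unfolding law by (subst integral_distr) auto
  finally show ?thesis
    unfolding W Z_def t_def by (simp add: curie_weiss_def)
qed

text \<open>
  Numerator and denominator of $P(W > z) = A/Z$ are close to $\kappa Q$ and $\kappa$ with $Q = 1 - \Phi(z)$; since $Z \ge 1$,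
  the absolute error of $Z$ is also a bound for its relative error.
\<close>

lemma curie_weiss_moderate_deviation:
  assumes \<beta>: "0 < \<beta>" "\<beta> < 1" and n: "1 \<le> n" and z: "0 \<le> z"
  defines "\<kappa> \<equiv> 1 / sqrt (1 - \<beta>)"
  defines "m3 \<equiv> (\<integral>g. normal_density 0 \<kappa> g * \<bar>g\<bar> ^ 3 \<partial>lborel)"
  shows "\<bar>measure (curie_weiss \<beta> \<rho> n) {x \<in> space (curie_weiss \<beta> \<rho> n). normalized_sum \<beta> n x > z}
      / (1 - std_normal_cdf z) - 1\<bar>
    \<le> (138240000 * exp 15376 / (1 - \<beta>)\<^sup>2 + 46 * \<kappa> * m3) * real n powr (- 1 / 2) * (1 + z ^ 3)"
proof -
  define Z where "Z = (\<integral>x. exp (\<beta> * x\<^sup>2 / 2) \<partial>sum_law n)"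
  define A where "A = (\<integral>x. indicator {z / sqrt (1 - \<beta>)<..} x * exp (\<beta> * x\<^sup>2 / 2) \<partial>sum_law n)"
  define Q where "Q = normal_tail z"
  define C where "C = 138240000 * exp 15376 / (1 - \<beta>)\<^sup>2"
  note Zb = exp_square_moment(2-4)[OF \<beta> n, folded \<kappa>_def, folded m3_def Z_def]
  have Ab: "\<bar>A - \<kappa> * Q\<bar> \<le> C / sqrt n * (1 + z ^ 3) * Q"
    using truncated_exp_square_moment[OF \<beta> n z] by (simp add: A_def Q_def C_def \<kappa>_def)
  have n0: "0 < sqrt n" using n by simp
  have Q: "0 < Q"
  proof -
    have "0 < 24 * (1 + z) * Q"
      using normal_tail_bounds(3)[OF z] unfolding Q_def by (rule less_le_trans[OF exp_gt_zero])
    then show ?thesis using z by (simp add: zero_less_mult_iff)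
  qed
  have z3: "1 \<le> 1 + z ^ 3" using z by simp
  have m: "0 \<le> 46 * \<kappa> * m3 / sqrt n" using Zb by linarith
  have "A / Z / Q - 1 = (A - \<kappa> * Q) / (Z * Q) + (\<kappa> - Z) / Z"
    using Q Zb by (simp add: field_simps)
  then have "\<bar>A / Z / Q - 1\<bar> \<le> \<bar>A - \<kappa> * Q\<bar> / (Z * Q) + \<bar>\<kappa> - Z\<bar> / Z"
    using Q Zb abs_triangle_ineq[of "(A - \<kappa> * Q) / (Z * Q)" "(\<kappa> - Z) / Z"] by (simp add: abs_divide abs_mult)
  also have "\<dots> \<le> C / sqrt n * (1 + z ^ 3) + 46 * \<kappa> * m3 / sqrt n * (1 + z ^ 3)"
  proof (rule add_mono)
    have "\<bar>A - \<kappa> * Q\<bar> / (Z * Q) \<le> \<bar>A - \<kappa> * Q\<bar> / (1 * Q)"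
      using Q Zb by (intro divide_left_mono mult_right_mono) auto
    also have "\<dots> \<le> C / sqrt n * (1 + z ^ 3)"
      using Ab Q by (simp add: divide_le_eq)
    finally show "\<bar>A - \<kappa> * Q\<bar> / (Z * Q) \<le> C / sqrt n * (1 + z ^ 3)" .
    have "\<bar>\<kappa> - Z\<bar> / Z \<le> \<bar>\<kappa> - Z\<bar> / 1"
      using Zb by (intro divide_left_mono) auto
    also have "\<dots> \<le> 46 * \<kappa> * m3 / sqrt n * 1"
      using Zb by simp
    also have "\<dots> \<le> 46 * \<kappa> * m3 / sqrt n * (1 + z ^ 3)"
      using m z3 by (rule mult_left_mono[rotated])
    finally show "\<bar>\<kappa> - Z\<bar> / Z \<le> 46 * \<kappa> * m3 / sqrt n * (1 + z ^ 3)" .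
  qed
  also have "\<dots> = (C + 46 * \<kappa> * m3) * real n powr (- 1 / 2) * (1 + z ^ 3)"
  proof -
    have "real n powr (- 1 / 2) = 1 / sqrt n"
      using n powr_minus[of "real n" "1 / 2"] by (simp add: powr_half_sqrt inverse_eq_divide)
    moreover have "C / r * w + x / r * w = (C + x) * (1 / r) * w" for r w x :: real
      by (simp add: distrib_right add_divide_distrib)
    ultimately show ?thesis
      by simp
  qed
  finally show ?thesis
    unfolding curie_weiss_tail[OF \<beta> n] normal_tail_eq_cdf A_def Z_def Q_def C_def .
qed

end

theorem theorem3p2:
  fixes \<beta> :: real
  assumes "0 < \<beta>" and "\<beta> < 1"
  shows "\<exists>C::real. \<forall>\<rho> :: real measure.
    real_distribution \<rho> \<and>
    integrable \<rho> (\<lambda>x. x) \<and> (LINT x|\<rho>. x) = 0 \<and>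
    integrable \<rho> (\<lambda>x. x\<^sup>2) \<and> (LINT x|\<rho>. x\<^sup>2) = 1 \<and>
    (\<forall>t::real. integrable \<rho> (\<lambda>x. exp (t * x)) \<and> (LINT x|\<rho>. exp (t * x)) \<le> exp (t\<^sup>2 / 2))
    \<longrightarrow> (\<forall>n::nat. \<forall>z::real. 1 \<le> n \<and> 0 \<le> z \<and> z \<le> sqrt (real n) \<longrightarrow>
          \<bar>measure (curie_weiss \<beta> \<rho> n)
              {x \<in> space (curie_weiss \<beta> \<rho> n). normalized_sum \<beta> n x > z}
            / (1 - std_normal_cdf z) - 1\<bar>
          \<le> C * real n powr (- 1 / 2) * (1 + z ^ 3))"
proof (intro exI allI impI, elim conjE)
  fix \<rho> :: "real measure" and n :: nat and z :: real
  assume \<rho>: "real_distribution \<rho>" "integrable \<rho> (\<lambda>x. x)" "(LINT x|\<rho>. x) = 0"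
    "integrable \<rho> (\<lambda>x. x\<^sup>2)" "(LINT x|\<rho>. x\<^sup>2) = 1"
    "\<forall>t::real. integrable \<rho> (\<lambda>x. exp (t * x)) \<and> (LINT x|\<rho>. exp (t * x)) \<le> exp (t\<^sup>2 / 2)"
  assume nz: "1 \<le> n" "0 \<le> z"
  interpret standard_subgaussian \<rho>
    using \<rho> by (simp add: standard_subgaussian_def standard_subgaussian_axioms_def)
  show "\<bar>measure (curie_weiss \<beta> \<rho> n) {x \<in> space (curie_weiss \<beta> \<rho> n). normalized_sum \<beta> n x > z}
      / (1 - std_normal_cdf z) - 1\<bar>
    \<le> (138240000 * exp 15376 / (1 - \<beta>)\<^sup>2
        + 46 * (1 / sqrt (1 - \<beta>)) * (\<integral>g. normal_density 0 (1 / sqrt (1 - \<beta>)) g * \<bar>g\<bar> ^ 3 \<partial>lborel))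
      * real n powr (- 1 / 2) * (1 + z ^ 3)"
    by (rule curie_weiss_moderate_deviation[OF assms nz])
qed

end
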